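(* Let $G$ be a non-discrete compactly generated totally disconnected locally compact group. Then $G$ has a compact normal subgroup $K$, which can be chosen to be a subgroup of any given open neighbourhood of the identity, such that for every compact open subgroup $U$ of $G$, the composition factors of $UK/K$ are of bounded order. In particular, the set $\eta = \eta(G/K)$ is finite and $UK/K$ is virtually pro-$\eta$ for every compact open subgroup $U$ of $G$.
   Context: The local prime content $\eta(H)$ of a totally disconnected locally compact group $H$ is the set of primes $p$ for which $H$ contains an infinite (compact) pro-$p$ subgroup. The composition factors of a profinite group are the composition factors of its finite continuous quotients. A profinite group is virtually pro-$\eta$ if it has an open pro-$\eta$ subgroup. *)

theory Defs
  imports
    "HOL-Analysis.Analysis"
    "HOL-Algebra.Generated_Groups"
    "HOL-Algebra.SimpleGroups"
begin

section \<open>Topological groups\<close>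

locale topological_group = group G for G :: "('a, 'b) monoid_scheme" (structure) +
  fixes T :: "'a topology"
  assumes topspace_eq_carrier: "topspace T = carrier G"
    and continuous_mult: "continuous_map (prod_topology T T) T (\<lambda>(x, y). x \<otimes> y)"
    and continuous_inv: "continuous_map T T (\<lambda>x. inv x)"

definition totally_disconnected_space :: "'a topology \<Rightarrow> bool"
  where "totally_disconnected_space T \<longleftrightarrow>
    (\<forall>x \<in> topspace T. connected_component_of_set T x = {x})"

text \<open>Locally compact groups are Hausdorff by convention; under total disconnectedness the
  Hausdorff condition is automatic.\<close>

definition tdlc_group :: "('a, 'b) monoid_scheme \<Rightarrow> 'a topology \<Rightarrow> bool"
  where "tdlc_group G T \<longleftrightarrow>
    topological_group G T \<and> Hausdorff_space T \<and> locally_compact_space T \<and>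
    totally_disconnected_space T"

definition compactly_generated_group :: "('a, 'b) monoid_scheme \<Rightarrow> 'a topology \<Rightarrow> bool"
  where "compactly_generated_group G T \<longleftrightarrow> (\<exists>C. compactin T C \<and> generate G C = carrier G)"

definition compact_open_subgroup :: "'a set \<Rightarrow> ('a, 'b) monoid_scheme \<Rightarrow> 'a topology \<Rightarrow> bool"
  where "compact_open_subgroup U G T \<longleftrightarrow> subgroup U G \<and> compactin T U \<and> openin T U"

text \<open>The quotient topology on \<open>G Mod K\<close>.\<close>

definition quotient_group_topology ::
    "('a, 'b) monoid_scheme \<Rightarrow> 'a topology \<Rightarrow> 'a set \<Rightarrow> 'a set topology"
  where "quotient_group_topology G T K =
    topology (\<lambda>V. V \<subseteq> carrier (G Mod K) \<and> openin T {x \<in> carrier G. K #>\<^bsub>G\<^esub> x \<in> V})"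

lemma openin_quotient_group_topology:
  "openin (quotient_group_topology G T K) V \<longleftrightarrow>
    V \<subseteq> carrier (G Mod K) \<and> openin T {x \<in> carrier G. K #>\<^bsub>G\<^esub> x \<in> V}"
proof -
  let ?P = "\<lambda>V. V \<subseteq> carrier (G Mod K) \<and> openin T {x \<in> carrier G. K #>\<^bsub>G\<^esub> x \<in> V}"
  have "?P (V \<inter> W)" if "?P V" "?P W" for V W
  proof -
    have "{x \<in> carrier G. K #>\<^bsub>G\<^esub> x \<in> V \<inter> W} =
        {x \<in> carrier G. K #>\<^bsub>G\<^esub> x \<in> V} \<inter> {x \<in> carrier G. K #>\<^bsub>G\<^esub> x \<in> W}"
      by blast
    with that show ?thesis by auto
  qed
  moreover have "?P (\<Union>\<V>)" if "\<forall>V\<in>\<V>. ?P V" for \<V>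
  proof -
    have "{x \<in> carrier G. K #>\<^bsub>G\<^esub> x \<in> \<Union>\<V>} = (\<Union>V\<in>\<V>. {x \<in> carrier G. K #>\<^bsub>G\<^esub> x \<in> V})"
      by blast
    moreover have "openin T (\<Union>V\<in>\<V>. {x \<in> carrier G. K #>\<^bsub>G\<^esub> x \<in> V})"
      using that by (intro openin_Union) auto
    ultimately show ?thesis using that by auto
  qed
  ultimately have "istopology ?P"
    unfolding istopology_def by blast
  then show ?thesis
    unfolding quotient_group_topology_def by (simp add: topology_inverse')
qed

lemma quotient_map_quotient_group_topology:
  assumes "topspace T = carrier G"
  shows "quotient_map T (quotient_group_topology G T K) (\<lambda>x. K #>\<^bsub>G\<^esub> x)"
proof -
  have c: "carrier (G Mod K) = (\<lambda>x. K #>\<^bsub>G\<^esub> x) ` carrier G"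
    by (auto simp: FactGroup_def RCOSETS_def)
  have "{x \<in> carrier G. K #>\<^bsub>G\<^esub> x \<in> carrier (G Mod K)} = topspace T"
    using assms c by auto
  then have "openin (quotient_group_topology G T K) (carrier (G Mod K))"
    by (simp add: openin_quotient_group_topology)
  then have "topspace (quotient_group_topology G T K) = carrier (G Mod K)"
    by (meson openin_quotient_group_topology openin_subset openin_topspace subset_antisym)
  then show ?thesis
    by (auto simp: quotient_map_def openin_quotient_group_topology assms c)
qed

text \<open>The subgroup \<open>UK/K\<close> of \<open>G Mod K\<close>; it carries the subspace topology.\<close>

definition image_in_quotient :: "('a, 'b) monoid_scheme \<Rightarrow> 'a set \<Rightarrow> 'a set \<Rightarrow> 'a set set"
  where "image_in_quotient G U K = (\<lambda>x. K #>\<^bsub>G\<^esub> x) ` (U <#>\<^bsub>G\<^esub> K)"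


section \<open>Composition factors\<close>

text \<open>\<open>Hs\<close> lists the terms of the series from the trivial subgroup upwards.\<close>

definition composition_series :: "('a, 'b) monoid_scheme \<Rightarrow> 'a set list \<Rightarrow> bool"
  where "composition_series G Hs \<longleftrightarrow>
    Hs \<noteq> [] \<and> hd Hs = {\<one>\<^bsub>G\<^esub>} \<and> last Hs = carrier G \<and>
    (\<forall>H \<in> set Hs. subgroup H G) \<and>
    (\<forall>i. Suc i < length Hs \<longrightarrow>
      Hs ! i \<lhd> G\<lparr>carrier := Hs ! Suc i\<rparr> \<and>
      simple_group (G\<lparr>carrier := Hs ! Suc i\<rparr> Mod Hs ! i))"

text \<open>By Jordan-Hoelder, different composition series give the same factors up to isomorphism;
  here the factors of all composition series are collected.\<close>

definition composition_factors :: "('a, 'b) monoid_scheme \<Rightarrow> 'a set monoid set"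
  where "composition_factors G =
    {G\<lparr>carrier := Hs ! Suc i\<rparr> Mod Hs ! i | Hs i. composition_series G Hs \<and> Suc i < length Hs}"


section \<open>Profinite groups\<close>

definition profinite_group :: "('a, 'b) monoid_scheme \<Rightarrow> 'a topology \<Rightarrow> bool"
  where "profinite_group G T \<longleftrightarrow>
    topological_group G T \<and> compact_space T \<and> Hausdorff_space T \<and> totally_disconnected_space T"

definition finite_continuous_quotients ::
    "('a, 'b) monoid_scheme \<Rightarrow> 'a topology \<Rightarrow> 'a set monoid set"
  where "finite_continuous_quotients G T =
    {G Mod N | N. N \<lhd> G \<and> openin T N \<and> finite (carrier (G Mod N))}"

definition profinite_composition_factors ::
    "('a, 'b) monoid_scheme \<Rightarrow> 'a topology \<Rightarrow> 'a set set monoid set"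
  where "profinite_composition_factors G T =
    (\<Union>Q \<in> finite_continuous_quotients G T. composition_factors Q)"

text \<open>Pro-\<open>\<pi>\<close> groups for a set of primes \<open>\<pi>\<close>; a pro-\<open>p\<close> group is a pro-\<open>{p}\<close> group.\<close>

definition pro_group :: "nat set \<Rightarrow> ('a, 'b) monoid_scheme \<Rightarrow> 'a topology \<Rightarrow> bool"
  where "pro_group \<pi> G T \<longleftrightarrow>
    profinite_group G T \<and>
    (\<forall>Q \<in> finite_continuous_quotients G T. \<forall>p. prime p \<and> p dvd order Q \<longrightarrow> p \<in> \<pi>)"

definition virtually_pro_group :: "nat set \<Rightarrow> ('a, 'b) monoid_scheme \<Rightarrow> 'a topology \<Rightarrow> bool"
  where "virtually_pro_group \<pi> G T \<longleftrightarrow>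
    profinite_group G T \<and>
    (\<exists>V. subgroup V G \<and> openin T V \<and> pro_group \<pi> (G\<lparr>carrier := V\<rparr>) (subtopology T V))"

definition local_prime_content :: "('a, 'b) monoid_scheme \<Rightarrow> 'a topology \<Rightarrow> nat set"
  where "local_prime_content G T =
    {p. prime p \<and>
      (\<exists>P. subgroup P G \<and> infinite P \<and> pro_group {p} (G\<lparr>carrier := P\<rparr>) (subtopology T P))}"

end

theory Submission
  imports Defs "HOL-Algebra.Sylow" "HOL-Algebra.Multiplicative_Group"
begin

text \<open>By van Dantzig's theorem there is a compact open subgroup \<open>U \<subseteq> W\<close>; take for \<open>K\<close> the
  intersection of all conjugates of \<open>U\<close>. Compact generation lets one step from a conjugate
  \<open>g U g\<^sup>-\<^sup>1\<close> to the conjugates by neighbours of \<open>g\<close> at the cost of intersecting with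
  \<open>g L g\<^sup>-\<^sup>1\<close> for one fixed open normal subgroup \<open>L\<close> of \<open>U\<close>. Hence every neighbourhood of the
  identity of \<open>G / K\<close> contains the end of a finite subnormal chain starting at \<open>U / K\<close> whose
  indices are at most \<open>|U : L|\<close>. This bounds the composition factors, and every prime of the
  local content. A prime outside the local content has finite Sylow subgroups, hence does not
  divide the indices below some open subgroup; intersecting over the finitely many such primes
  up to the bound gives the open pro-\<open>\<eta>\<close> subgroup.\<close>

section \<open>Subnormal chains\<close>

text \<open>The subgroup \<open>L\<close> is \<open>W 1\<close>: the elements of \<open>U\<close>
  whose conjugates by \<open>D\<close>, that is by \<open>U\<close> times the generators and their
  inverses, stay in \<open>U\<close>. Compactness of the generating set makes \<open>W 1\<close>
  open, and the factor \<open>U\<close> makes it normal in \<open>U\<close>; its index is a bound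
  that serves all conjugates alike. One chain only reaches inside one conjugate of \<open>U\<close>.
  To enter an arbitrary neighbourhood, ends of chains are intersected, which does not raise the
  bound, and compactness of \<open>U\<close> leaves finitely many to intersect. The bound concerns
  indices, the local prime content concerns primes; the link is made by powers of single elements.
  For a prime \<open>q\<close> above the bound, every element of \<open>U\<close> has a power in any
  given neighbourhood whose exponent is prime to \<open>q\<close>. A profinite group all of whose
  elements have this property for every prime outside a set is a pro-group for that set. Hence the
  primes above the bound, infinite in number, need no shrinking of the subgroup.\<close>

text \<open>This plays the role of \<open>A / B\<close>, its cardinality that of the index. All
  cosets are formed in the ambient \<open>G\<close>, so that subgroups of subgroups are compared
  directly, and \<open>B\<close> may fail to lie in \<open>A\<close>, as with the cosets of
  \<open>Y\<close> by elements of \<open>N\<close> in \<open>cosets_normal_dvd\<close>.\<close>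

definition cosets :: "('a, 'b) monoid_scheme \<Rightarrow> 'a set \<Rightarrow> 'a set \<Rightarrow> 'a set set"
  where "cosets G A B = (\<lambda>a. B #>\<^bsub>G\<^esub> a) ` A"

lemma card_image_factor:
  assumes "finite (r ` A)" and "\<And>x y. x \<in> A \<Longrightarrow> y \<in> A \<Longrightarrow> r x = r y \<Longrightarrow> s x = s y"
  shows "finite (s ` A)" "card (s ` A) \<le> card (r ` A)"
proof -
  have "s x = s (inv_into A r (r x))" if "x \<in> A" for x
    using assms(2)[of x "inv_into A r (r x)"] that by (simp add: f_inv_into_f inv_into_into)
  then have *: "s ` A = (\<lambda>c. s (inv_into A r c)) ` (r ` A)"
    by (simp add: image_image cong: image_cong)
  show "finite (s ` A)" using * assms(1) by simp
  show "card (s ` A) \<le> card (r ` A)" using * card_image_le[OF assms(1)] by metis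
qed

context group
begin

lemma rcos_eq_iff:
  assumes "subgroup B G" "a \<in> carrier G" "a' \<in> carrier G"
  shows "B #> a = B #> a' \<longleftrightarrow> a \<otimes> inv a' \<in> B"
proof -
  have "a \<in> B #> a' \<longleftrightarrow> a \<otimes> inv a' \<in> B"
    using subgroup.rcos_module[OF assms(1) is_group assms(3,2)] .
  moreover have "B #> a = B #> a' \<longleftrightarrow> a \<in> B #> a'"
    using repr_independence[OF _ assms(3,1), of a] rcos_self[OF assms(2,1)] by metis
  ultimately show ?thesis by blast
qed

lemma normal_carrier_iff:
  assumes "subgroup A G"
  shows "B \<lhd> G\<lparr>carrier := A\<rparr> \<longleftrightarrow>
    subgroup B G \<and> B \<subseteq> A \<and> (\<forall>a\<in>A. \<forall>b\<in>B. a \<otimes> b \<otimes> inv a \<in> B)"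
proof -
  interpret GA: group "G\<lparr>carrier := A\<rparr>" using assms by (rule subgroup_imp_group)
  have "subgroup B (G\<lparr>carrier := A\<rparr>) \<longleftrightarrow> subgroup B G \<and> B \<subseteq> A"
    using incl_subgroup[OF assms, of B] subgroup_incl[OF _ assms, of B]
      subgroup.subset[of B "G\<lparr>carrier := A\<rparr>"] by auto
  then show ?thesis
    using assms by (auto simp: GA.normal_inv_iff m_inv_consistent)
qed

lemma normal_carrierI:
  assumes "subgroup A G" "subgroup B G" "B \<subseteq> A" "\<And>a b. a \<in> A \<Longrightarrow> b \<in> B \<Longrightarrow> a \<otimes> b \<otimes> inv a \<in> B"
  shows "B \<lhd> G\<lparr>carrier := A\<rparr>"
  using assms by (simp add: normal_carrier_iff)

lemma rcosets_restrict: "rcosets\<^bsub>G\<lparr>carrier := A\<rparr>\<^esub> B = cosets G A B"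
  by (auto simp: RCOSETS_def cosets_def)

lemma carrier_Mod_restrict: "carrier (G\<lparr>carrier := A\<rparr> Mod B) = cosets G A B"
  by (simp add: FactGroup_def rcosets_restrict)

text \<open>For \<open>x\<close> and \<open>y\<close> in \<open>N\<close> the element
  \<open>x \<otimes> inv y\<close> lies in \<open>N\<close> anyway, so a coset of \<open>B\<close>
  determines the coset of \<open>N \<inter> B\<close>.\<close>

lemma card_cosets_Int:
  assumes "subgroup A G" "subgroup B G" "subgroup N G" "finite (cosets G A B)"
  shows "finite (cosets G (N \<inter> A) (N \<inter> B))" "card (cosets G (N \<inter> A) (N \<inter> B)) \<le> card (cosets G A B)"
proof -
  have sub: "subgroup (N \<inter> B) G" using assms subgroups_Inter_pair by blast
  have fin: "finite ((\<lambda>a. B #> a) ` (N \<inter> A))"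
    using assms(4) by (rule finite_subset[rotated]) (auto simp: cosets_def)
  have *: "(N \<inter> B) #> x = (N \<inter> B) #> y"
    if "x \<in> N \<inter> A" "y \<in> N \<inter> A" "B #> x = B #> y" for x y
  proof -
    have c: "x \<in> carrier G" "y \<in> carrier G" using that assms(3) subgroup.mem_carrier by auto
    have "x \<otimes> inv y \<in> N" using that assms(3) by (simp add: subgroup.m_closed subgroup.m_inv_closed)
    then show ?thesis using that c assms(2) sub by (simp add: rcos_eq_iff)
  qed
  show "finite (cosets G (N \<inter> A) (N \<inter> B))"
    unfolding cosets_def using fin * by (rule card_image_factor(1))
  have "card (cosets G (N \<inter> A) (N \<inter> B)) \<le> card ((\<lambda>a. B #> a) ` (N \<inter> A))"
    unfolding cosets_def using fin * by (rule card_image_factor(2))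
  also have "\<dots> \<le> card (cosets G A B)"
    using assms(4) by (intro card_mono) (auto simp: cosets_def)
  finally show "card (cosets G (N \<inter> A) (N \<inter> B)) \<le> card (cosets G A B)" .
qed

end

text \<open>Read downwards from the fixed top \<open>X\<close>. The factors need not be simple; only
  their orders are bounded. Finiteness is demanded separately since an infinite set has cardinality
  0.\<close>

inductive subnormal_chain :: "('a, 'b) monoid_scheme \<Rightarrow> nat \<Rightarrow> 'a set \<Rightarrow> 'a set \<Rightarrow> bool"
  for G m X where
  refl: "subgroup X G \<Longrightarrow> subnormal_chain G m X X"
| step: "subnormal_chain G m X A \<Longrightarrow> B \<lhd> G\<lparr>carrier := A\<rparr> \<Longrightarrow> finite (cosets G A B) \<Longrightarrow>
    card (cosets G A B) \<le> m \<Longrightarrow> subnormal_chain G m X B"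

lemma chain_trans: "subnormal_chain G m Y Z \<Longrightarrow> subnormal_chain G m X Y \<Longrightarrow> subnormal_chain G m X Z"
  by (induction rule: subnormal_chain.induct) (auto intro: subnormal_chain.step)

lemma chain_mono: "subnormal_chain G m X Y \<Longrightarrow> m \<le> n \<Longrightarrow> subnormal_chain G n X Y"
  by (induction rule: subnormal_chain.induct) (auto intro: subnormal_chain.intros order_trans)

context group
begin

lemma chainD:
  assumes "subnormal_chain G m X M"
  shows "subgroup X G" "subgroup M G" "M \<subseteq> X"
proof -
  have "subgroup X G \<and> subgroup M G \<and> M \<subseteq> X"
    using assms
  proof induction
    case (step A B)
    then show ?case using normal_carrier_iff[of A B] by blast
  qed simp
  then show "subgroup X G" "subgroup M G" "M \<subseteq> X" by auto
qed

lemma chain_Int: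
  assumes "subnormal_chain G m X M" "subgroup N G" "N \<subseteq> X"
  shows "subnormal_chain G m N (N \<inter> M)"
  using assms
proof induction
  case refl
  then show ?case by (simp add: subnormal_chain.refl inf.absorb1)
next
  case (step A B)
  have A: "subgroup A G" using step.hyps chainD by blast
  then have B: "subgroup B G" "B \<subseteq> A" and nB: "\<And>a b. a \<in> A \<Longrightarrow> b \<in> B \<Longrightarrow> a \<otimes> b \<otimes> inv a \<in> B"
    using step.hyps normal_carrier_iff[of A B] by auto
  have NA: "subnormal_chain G m N (N \<inter> A)" using step by blast
  have "N \<inter> B \<lhd> G\<lparr>carrier := N \<inter> A\<rparr>"
  proof (rule normal_carrierI)
    show "a \<otimes> b \<otimes> inv a \<in> N \<inter> B" if "a \<in> N \<inter> A" "b \<in> N \<inter> B" for a b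
      using that nB[of a b] subgroup.m_closed[OF step.prems(1)] subgroup.m_inv_closed[OF step.prems(1)]
      by auto
  qed (use B chainD[OF NA] subgroups_Inter_pair[OF step.prems(1) B(1)] in blast)+
  then show ?case
    using subnormal_chain.step[OF NA] card_cosets_Int[OF A B(1) step.prems(1) step.hyps(3)] step.hyps(4)
    by (meson order_trans)
qed

text \<open>Follow the first chain down to \<open>M\<close>, then the second chain cut down to
  \<open>M\<close>. The bound stays \<open>m\<close>, so the ends of chains form a family closed
  under intersection, as the compactness argument requires.\<close>

lemma chain_Int_chain:
  assumes "subnormal_chain G m X M" "subnormal_chain G m X M'"
  shows "subnormal_chain G m X (M \<inter> M')"
  using chain_trans[OF chain_Int[OF assms(2)] assms(1)] chainD[OF assms(1)] by blast

lemma chain_restrict: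
  assumes "subnormal_chain G m X M" "subgroup V G" "X \<subseteq> V"
  shows "subnormal_chain (G\<lparr>carrier := V\<rparr>) m X M"
  using assms
proof induction
  case refl
  then show ?case by (intro subnormal_chain.refl subgroup_incl)
next
  case (step A B)
  have "subnormal_chain (G\<lparr>carrier := V\<rparr>) m X A" using step by blast
  then show ?case by (rule subnormal_chain.step) (use step.hyps in \<open>simp_all add: cosets_def\<close>)
qed

end

text \<open>A coset of \<open>B\<close> determines the coset of its image, so no index grows. With
  \<open>h\<close> a quotient map this produces chains in finite quotients.\<close>

lemma (in group_hom) chain_hom:
  assumes "subnormal_chain G m X M"
  shows "subnormal_chain H m (h ` X) (h ` M)"
  using assms
proof induction
  case refl
  then show ?case by (intro subnormal_chain.refl subgroup_img_is_subgroup)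
next
  case (step A B)
  have A: "subgroup A G" using step.hyps G.chainD by blast
  then have B: "subgroup B G" "B \<subseteq> A" and nB: "\<And>a b. a \<in> A \<Longrightarrow> b \<in> B \<Longrightarrow> a \<otimes> b \<otimes> inv a \<in> B"
    using step.hyps G.normal_carrier_iff[of A B] by auto
  note mem = subgroup.mem_carrier[OF A] subgroup.mem_carrier[OF B(1)]
  have hB: "subgroup (h ` B) H" using B by (intro subgroup_img_is_subgroup)
  have "h ` B \<lhd> H\<lparr>carrier := h ` A\<rparr>"
  proof (rule H.normal_carrierI)
    fix a b assume "a \<in> h ` A" "b \<in> h ` B"
    then obtain x y where "a = h x" "x \<in> A" "b = h y" "y \<in> B" by blast
    then show "a \<otimes>\<^bsub>H\<^esub> b \<otimes>\<^bsub>H\<^esub> inv\<^bsub>H\<^esub> a \<in> h ` B"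
      using imageI[OF nB[of x y], of h] mem by simp
  qed (use A B hB subgroup_img_is_subgroup in auto)
  moreover have *: "h ` B #>\<^bsub>H\<^esub> h x = h ` B #>\<^bsub>H\<^esub> h y"
    if "x \<in> A" "y \<in> A" "B #>\<^bsub>G\<^esub> x = B #>\<^bsub>G\<^esub> y" for x y
  proof -
    have "x \<otimes>\<^bsub>G\<^esub> inv\<^bsub>G\<^esub> y \<in> B" using that mem B by (simp add: G.rcos_eq_iff)
    then have "h (x \<otimes>\<^bsub>G\<^esub> inv\<^bsub>G\<^esub> y) \<in> h ` B" by blast
    then show ?thesis using hB that mem by (simp add: H.rcos_eq_iff)
  qed
  have "finite (cosets H (h ` A) (h ` B)) \<and> card (cosets H (h ` A) (h ` B)) \<le> card (cosets G A B)"
    using card_image_factor[of "\<lambda>a. B #>\<^bsub>G\<^esub> a" A "\<lambda>a. h ` B #>\<^bsub>H\<^esub> h a"] * step.hyps(3)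
    unfolding cosets_def image_image by blast
  ultimately show ?case
    using subnormal_chain.step[OF step.IH] step.hyps(4) by (meson order_trans)
qed

section \<open>Powers of elements, indices and Sylow subgroups\<close>

context group
begin

text \<open>In a step from \<open>A\<close> to \<open>B\<close>, two of the \<open>m + 1\<close>
  powers of \<open>y = x [^] a\<close> with exponents 0 to \<open>m\<close> share a coset of
  \<open>B\<close>, so \<open>y [^] (j - i)\<close> lies in \<open>B\<close> with
  \<open>0 < j - i \<le> m < q\<close>. The exponent is thus multiplied by a number that
  \<open>q\<close> cannot divide.\<close>

lemma chain_pow:
  assumes "subnormal_chain G m X M" "prime q" "m < q" "x \<in> X"
  shows "\<exists>a. \<not> q dvd a \<and> x [^] a \<in> M"
  using assms
proof induction
  case refl
  then show ?case
    by (intro exI[of _ "1::nat"]) (auto simp: subgroup.mem_carrier)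
next
  case (step A B)
  have A: "subgroup A G" using step.hyps chainD by blast
  then have B: "subgroup B G" "B \<subseteq> A"
    using step.hyps normal_carrier_iff[of A B] by auto
  obtain a where a: "\<not> q dvd a" "x [^] a \<in> A" using step by blast
  have x: "x \<in> carrier G"
    using subgroup.mem_carrier[OF chainD(1)[OF step.hyps(1)]] step.prems(3) by simp
  let ?y = "x [^] a"
  have y: "?y \<in> carrier G" using x by simp
  have yp: "?y [^] i \<in> A" for i :: nat
    using a(2) A by (induction i) (auto simp: subgroup.m_closed subgroup.one_closed)
  have "\<not> inj_on (\<lambda>i::nat. B #> (?y [^] i)) {..m}"
  proof (rule pigeonhole)
    have "(\<lambda>i::nat. B #> (?y [^] i)) ` {..m} \<subseteq> cosets G A B"
      using yp by (auto simp: cosets_def)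
    then have "card ((\<lambda>i::nat. B #> (?y [^] i)) ` {..m}) \<le> card (cosets G A B)"
      using step.hyps(3) by (rule card_mono[rotated])
    then show "card ((\<lambda>i::nat. B #> (?y [^] i)) ` {..m}) < card {..m}" using step.hyps(4) by simp
  qed
  then obtain i j where ij: "i < j" "j \<le> m" "B #> (?y [^] j) = B #> (?y [^] i)"
    using linorder_inj_onI'[of "{..m}" "\<lambda>i. B #> (?y [^] i)"] by force
  have "?y [^] j \<otimes> inv (?y [^] i) \<in> B"
    using ij y B by (simp add: rcos_eq_iff)
  moreover have "?y [^] j = ?y [^] (j - i) \<otimes> ?y [^] i"
    using ij y by (simp add: nat_pow_mult)
  ultimately have "?y [^] (j - i) \<in> B"
    using y by (simp add: m_assoc)
  then have "x [^] (a * (j - i)) \<in> B" using x by (simp add: nat_pow_pow)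
  moreover have "\<not> q dvd a * (j - i)"
    using a(1) ij step.prems by (auto simp: prime_dvd_mult_iff dest: dvd_imp_le)
  ultimately show ?case by blast
qed

lemma coprime_pow_mem:
  assumes "subgroup M G" "x \<in> carrier G" "x [^] (a::nat) \<in> M" "x [^] (b::nat) \<in> M" "coprime a b"
  shows "x \<in> M"
proof (cases "a = 0")
  case True
  then have "b = 1" using assms by simp
  then show ?thesis using assms by simp
next
  case False
  obtain u v where uv: "a * u = b * v + 1"
    using bezout_nat[of a b] False assms(5) by (auto simp: coprime_iff_gcd_eq_1)
  have pM: "y [^] n \<in> M" if "y \<in> M" for y and n :: nat
    using that assms(1) by (induction n) (auto simp: subgroup.m_closed subgroup.one_closed)
  have "x [^] (a * u) \<in> M" "x [^] (b * v) \<in> M"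
    using pM[OF assms(3)] pM[OF assms(4)] assms(2) by (auto simp: nat_pow_pow)
  then have "inv (x [^] (b * v)) \<otimes> x [^] (a * u) \<in> M"
    using assms(1) by (simp add: subgroup.m_closed subgroup.m_inv_closed)
  moreover have "x [^] (a * u) = x [^] (b * v) \<otimes> x" using uv by simp
  ultimately show ?thesis using assms(2) by (simp flip: m_assoc)
qed

end

lemma (in group_hom) subgroup_preimage:
  assumes "subgroup P H"
  shows "subgroup {a \<in> carrier G. h a \<in> P} G"
proof (rule G.subgroupI)
  show "{a \<in> carrier G. h a \<in> P} \<noteq> {}"
    using subgroup.one_closed[OF assms] hom_one by force
qed (use subgroup.m_closed[OF assms] subgroup.m_inv_closed[OF assms] in auto)

context group
begin

lemma inv_cancel:
  assumes "x \<in> carrier G" "y \<in> carrier G"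
  shows "inv x \<otimes> (x \<otimes> y) = y" "x \<otimes> (inv x \<otimes> y) = y"
  using assms by (simp_all flip: m_assoc)

lemma subgroup_pow_mem: "subgroup A G \<Longrightarrow> x \<in> A \<Longrightarrow> x [^] (n::nat) \<in> A"
  by (induction n) (simp_all add: subgroup.m_closed subgroup.one_closed)

lemma rcos_Mod_pow:
  assumes "subgroup A G" "B \<lhd> G\<lparr>carrier := A\<rparr>" "x \<in> A"
  shows "(B #> x) [^]\<^bsub>G\<lparr>carrier := A\<rparr> Mod B\<^esub> (n::nat) = B #> (x [^] n)"
  using normal.FactGroup_pow[OF assms(2), of x n] assms(3)
  by (simp add: nat_pow_consistent[symmetric])

lemma pow_index_mem:
  assumes "subgroup A G" "B \<lhd> G\<lparr>carrier := A\<rparr>" "x \<in> A"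
  shows "x [^] card (cosets G A B) \<in> B"
proof -
  interpret Q: group "G\<lparr>carrier := A\<rparr> Mod B" using assms(2) by (rule normal.factorgroup_is_group)
  have B: "subgroup B G" using assms normal_carrier_iff by blast
  have "B #> x \<in> carrier (G\<lparr>carrier := A\<rparr> Mod B)"
    using assms(3) by (simp add: carrier_Mod_restrict cosets_def)
  then have "(B #> x) [^]\<^bsub>G\<lparr>carrier := A\<rparr> Mod B\<^esub> order (G\<lparr>carrier := A\<rparr> Mod B) = B"
    using Q.pow_order_eq_1 by simp
  then have "B #> (x [^] card (cosets G A B)) = B"
    using rcos_Mod_pow[OF assms] by (simp add: order_def carrier_Mod_restrict)
  moreover have "x [^] card (cosets G A B) \<in> carrier G"
    using subgroup.mem_carrier[OF assms(1,3)] by simp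
  ultimately show ?thesis using rcos_self[OF _ B] by metis
qed

text \<open>The set product \<open>B <#> c\<close> is the coset of \<open>B\<close> that contains
  the coset \<open>c\<close> of \<open>C\<close>, which gives the projection without choosing
  representatives. Its fibre over \<open>B #> a\<close> is the translate by \<open>a\<close> of the
  cosets of \<open>C\<close> in \<open>B\<close>.\<close>

lemma cosets_tower:
  assumes "subgroup A G" "subgroup B G" "subgroup C G" "C \<subseteq> B" "B \<subseteq> A" "finite (cosets G A C)"
  shows "card (cosets G A C) = card (cosets G A B) * card (cosets G B C)"
proof -
  note [simp] = subgroup.mem_carrier[OF assms(1)] subgroup.mem_carrier[OF assms(2)]
    subgroup.mem_carrier[OF assms(3)]
  have BC: "B <#> (C #> a) = B #> a" if "a \<in> A" for a
  proof -
    have "B <#> (C #> a) = (B <#> C) #> a"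
      using that subgroup.subset[OF assms(2)] subgroup.subset[OF assms(3)]
      by (simp add: setmult_rcos_assoc)
    also have "B <#> C = B"
    proof
      show "B <#> C \<subseteq> B" 
        using assms(4) subgroup.m_closed[OF assms(2)] by (auto simp: set_mult_def)
      show "B \<subseteq> B <#> C"
        using subgroup.one_closed[OF assms(3)] by (force simp: set_mult_def)
    qed
    finally show ?thesis .
  qed
  have img: "(\<lambda>c. B <#> c) ` cosets G A C = cosets G A B"
    using BC by (auto simp: cosets_def image_image)
  have fib: "card {c \<in> cosets G A C. B <#> c = d} = card (cosets G B C)" if d: "d \<in> cosets G A B" for d
  proof -
    obtain a where a: "a \<in> A" "d = B #> a" using d by (auto simp: cosets_def)
    have "{c \<in> cosets G A C. B <#> c = d} = (\<lambda>c. c #> a) ` cosets G B C"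
    proof (intro equalityI subsetI)
      fix c assume "c \<in> {c \<in> cosets G A C. B <#> c = d}"
      then obtain x where x: "x \<in> A" "c = C #> x" "B #> x = B #> a"
        using BC a by (auto simp: cosets_def)
      then have xa: "x \<otimes> inv a \<in> B" using a assms by (simp add: rcos_eq_iff)
      have "c = (C #> (x \<otimes> inv a)) #> a"
        using x a assms subgroup.subset[OF assms(3)] by (simp add: coset_mult_assoc m_assoc)
      then show "c \<in> (\<lambda>c. c #> a) ` cosets G B C" using xa by (auto simp: cosets_def)
    next
      fix c assume "c \<in> (\<lambda>c. c #> a) ` cosets G B C"
      then obtain b where b: "b \<in> B" "c = (C #> b) #> a" by (auto simp: cosets_def)
      then have c: "c = C #> (b \<otimes> a)" and bA: "b \<otimes> a \<in> A"
        using a assms subgroup.subset[OF assms(3)] subgroup.m_closed[OF assms(1)]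
        by (auto simp: coset_mult_assoc)
      have "B #> (b \<otimes> a) = B #> a"
        using a b assms by (simp add: rcos_eq_iff m_assoc)
      then show "c \<in> {c \<in> cosets G A C. B <#> c = d}"
        using c bA BC a by (auto simp: cosets_def)
    qed
    moreover have "inj_on (\<lambda>c. c #> a) (cosets G B C)"
    proof (rule inj_onI)
      fix c c' assume "c \<in> cosets G B C" "c' \<in> cosets G B C" and eq: "c #> a = c' #> a"
      then have "c \<subseteq> carrier G" "c' \<subseteq> carrier G"
        using subgroup.subset[OF assms(3)] by (auto simp: cosets_def r_coset_def)
      then have "(c #> a) #> inv a = c" "(c' #> a) #> inv a = c'"
        using a by (simp_all add: coset_mult_assoc)
      then show "c = c'" unfolding eq by (rule trans[OF sym])
    qed
    ultimately show ?thesis by (simp add: card_image)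
  qed
  have "card (cosets G A C) = (\<Sum>d\<in>cosets G A B. card {c \<in> cosets G A C. B <#> c = d})"
    using sum.image_gen[OF assms(6), of "\<lambda>_. 1::nat" "\<lambda>c. B <#> c"] img by simp
  then show ?thesis using fib by simp
qed

text \<open>By the second isomorphism theorem \<open>|N : N \<inter> Y| = |N Y : Y|\<close>, where
  \<open>N Y\<close> is a subgroup because \<open>N\<close> is normal, and this divides
  \<open>|H : Y|\<close>. An index prime to \<open>p\<close> thereby passes from \<open>Y\<close> to
  \<open>N \<inter> Y\<close>.\<close>

lemma cosets_normal_dvd:
  assumes "subgroup H G" "N \<lhd> G\<lparr>carrier := H\<rparr>" "subgroup Y G" "Y \<subseteq> H" "finite (cosets G H Y)"
  shows "card (cosets G N (N \<inter> Y)) dvd card (cosets G H Y)"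
proof -
  have N: "subgroup N G" "N \<subseteq> H" "\<And>a b. a \<in> H \<Longrightarrow> b \<in> N \<Longrightarrow> a \<otimes> b \<otimes> inv a \<in> N"
    using assms(1,2) by (auto simp: normal_carrier_iff)
  note mem = subgroup.mem_carrier[OF assms(1)] subgroup.mem_carrier[OF assms(3)]
    subgroup.mem_carrier[OF N(1)]
  have NY: "subgroup (N <#> Y) G"
  proof (rule subgroupI)
    show "N <#> Y \<subseteq> carrier G" using mem by (auto simp: set_mult_def)
    show "N <#> Y \<noteq> {}" using N(1) assms(3) subgroup.one_closed by (force simp: set_mult_def)
  next
    fix x assume "x \<in> N <#> Y"
    then obtain n y where ny: "n \<in> N" "y \<in> Y" "x = n \<otimes> y" by (auto simp: set_mult_def)
    have y': "inv y \<in> Y" using ny assms(3) by (simp add: subgroup.m_inv_closed)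
    moreover have "inv y \<otimes> inv n \<otimes> inv (inv y) \<in> N"
      using ny y' assms(4) N(3)[of "inv y" "inv n"] subgroup.m_inv_closed[OF N(1)] by blast
    moreover have "inv x = (inv y \<otimes> inv n \<otimes> inv (inv y)) \<otimes> inv y"
      using ny mem by (simp add: inv_mult_group m_assoc)
    ultimately show "inv x \<in> N <#> Y" by (auto simp: set_mult_def)
  next
    fix x x' assume "x \<in> N <#> Y" "x' \<in> N <#> Y"
    then obtain n y n' y' where ny: "n \<in> N" "y \<in> Y" "x = n \<otimes> y" "n' \<in> N" "y' \<in> Y" "x' = n' \<otimes> y'"
      by (auto simp: set_mult_def)
    have "y \<otimes> y' \<in> Y" using ny assms(3) by (simp add: subgroup.m_closed)
    moreover have "n \<otimes> (y \<otimes> n' \<otimes> inv y) \<in> N"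
      using ny assms(4) N(3)[of y n'] subgroup.m_closed[OF N(1)] by blast
    moreover have "x \<otimes> x' = (n \<otimes> (y \<otimes> n' \<otimes> inv y)) \<otimes> (y \<otimes> y')"
      using ny mem by (simp add: m_assoc inv_solve_left)
    ultimately show "x \<otimes> x' \<in> N <#> Y" by (force simp: set_mult_def)
  qed
  have sub: "Y \<subseteq> N <#> Y" "N <#> Y \<subseteq> H" "N \<subseteq> N <#> Y"
  proof -
    show "Y \<subseteq> N <#> Y" using mem subgroup.one_closed[OF N(1)] by (force simp: set_mult_def)
    show "N \<subseteq> N <#> Y" using mem subgroup.one_closed[OF assms(3)] by (force simp: set_mult_def)
    show "N <#> Y \<subseteq> H" using N(2) assms(4) subgroup.m_closed[OF assms(1)] by (auto simp: set_mult_def)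
  qed
  have eq: "cosets G (N <#> Y) Y = cosets G N Y"
  proof
    show "cosets G N Y \<subseteq> cosets G (N <#> Y) Y" using sub(3) by (auto simp: cosets_def)
    show "cosets G (N <#> Y) Y \<subseteq> cosets G N Y"
    proof
      fix c assume "c \<in> cosets G (N <#> Y) Y"
      then obtain x where x: "x \<in> N <#> Y" "c = Y #> x" by (auto simp: cosets_def)
      \<comment> \<open>Right cosets of \<open>Y\<close> absorb factors from \<open>Y\<close> on the
        left, while \<open>N <#> Y\<close> has them on the right; passing to the inverse swaps the
        sides.\<close>
      have "inv x \<in> N <#> Y" using x(1) NY by (simp add: subgroup.m_inv_closed)
      then obtain n y where ny: "n \<in> N" "y \<in> Y" "inv x = n \<otimes> y" by (auto simp: set_mult_def)
      have xc: "x \<in> carrier G" using x(1) NY by (simp add: subgroup.mem_carrier)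
      have "x = inv (n \<otimes> y)" using ny(3) xc inv_inv by metis
      then have xx: "x = inv y \<otimes> inv n" using ny mem by (simp add: inv_mult_group)
      have "x \<otimes> inv (inv n) = inv y" using xx ny mem by (simp add: m_assoc)
      moreover have "inv y \<in> Y" using ny assms(3) by (simp add: subgroup.m_inv_closed)
      ultimately have "Y #> x = Y #> (inv n)"
        using xc ny mem assms(3) by (simp add: rcos_eq_iff)
      then show "c \<in> cosets G N Y"
        using x ny subgroup.m_inv_closed[OF N(1)] by (auto simp: cosets_def)
    qed
  qed
  have fin: "finite (cosets G N Y)"
    using assms(5) N(2) by (rule_tac finite_subset[rotated]) (auto simp: cosets_def)
  have NYs: "subgroup (N \<inter> Y) G" using subgroups_Inter_pair[OF N(1) assms(3)] .
  have iff: "(N \<inter> Y) #> x = (N \<inter> Y) #> y \<longleftrightarrow> Y #> x = Y #> y" if "x \<in> N" "y \<in> N" for x y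
    using that mem NYs assms(3) subgroup.m_closed[OF N(1)] subgroup.m_inv_closed[OF N(1)]
    by (simp add: rcos_eq_iff)
  have "card (cosets G N (N \<inter> Y)) = card (cosets G N Y)"
  proof (rule antisym)
    show "card (cosets G N (N \<inter> Y)) \<le> card (cosets G N Y)"
      using card_image_factor(2)[of "\<lambda>x. Y #> x" N "\<lambda>x. (N \<inter> Y) #> x"] fin iff
      by (simp add: cosets_def)
    have "finite (cosets G N (N \<inter> Y))"
      using card_image_factor(1)[of "\<lambda>x. Y #> x" N "\<lambda>x. (N \<inter> Y) #> x"] fin iff
      by (simp add: cosets_def)
    then show "card (cosets G N Y) \<le> card (cosets G N (N \<inter> Y))"
      using card_image_factor(2)[of "\<lambda>x. (N \<inter> Y) #> x" N "\<lambda>x. Y #> x"] iff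
      by (simp add: cosets_def)
  qed
  moreover have "card (cosets G H Y) = card (cosets G H (N <#> Y)) * card (cosets G (N <#> Y) Y)"
    using assms NY sub by (intro cosets_tower) auto
  ultimately show ?thesis using eq by simp
qed

text \<open>The preimage in \<open>A\<close> of a Sylow subgroup of the finite quotient
  \<open>A / N\<close>. Since \<open>A\<close> is arbitrary, the construction can be iterated inside
  an earlier choice.\<close>

lemma sylow_between:
  assumes "subgroup A G" "N \<lhd> G\<lparr>carrier := A\<rparr>" "finite (cosets G A N)" "prime p"
  obtains S k where "subgroup S G" "N \<subseteq> S" "S \<subseteq> A" "card (cosets G S N) = p ^ k"
    "\<not> p dvd card (cosets G A S)"
proof -
  let ?Q = "G\<lparr>carrier := A\<rparr> Mod N"
  have N: "subgroup N G" "N \<subseteq> A"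
    using assms(1,2) by (auto simp: normal_carrier_iff)
  interpret A: group "G\<lparr>carrier := A\<rparr>" using assms(1) by (rule subgroup_imp_group)
  interpret h: group_hom "G\<lparr>carrier := A\<rparr>" ?Q "\<lambda>a. N #> a"
    using normal.r_coset_hom_Mod[OF assms(2)] normal.factorgroup_is_group[OF assms(2)]
    by (simp add: group_hom_def group_hom_axioms_def A.is_group)
  have ord: "order ?Q = card (cosets G A N)" by (simp add: order_def carrier_Mod_restrict)
  have fin: "finite (carrier ?Q)" using assms(3) by (simp add: carrier_Mod_restrict)
  then have "order ?Q \<noteq> 0" using h.H.order_gt_0_iff_finite by simp
  then obtain r where r: "order ?Q = p ^ multiplicity p (order ?Q) * r" "\<not> p dvd r"
    using multiplicity_decompose'[of "order ?Q" p] assms(4) by (metis not_prime_unit)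
  obtain P where P: "subgroup P ?Q" "card P = p ^ multiplicity p (order ?Q)"
    using sylow_thm[OF assms(4) h.H.is_group r(1) fin] by blast
  define S where "S = {a \<in> A. N #> a \<in> P}"
  have "subgroup S (G\<lparr>carrier := A\<rparr>)"
    using h.subgroup_preimage[OF P(1)] by (simp add: S_def)
  then have S: "subgroup S G" using incl_subgroup[OF assms(1)] by blast
  have "cosets G S N = P"
    using subgroup.subset[OF P(1)] by (auto simp: cosets_def S_def carrier_Mod_restrict)
  moreover have "N \<subseteq> S"
  proof
    fix x assume "x \<in> N"
    then have "N #> x = N" using coset_join3 N
      by (metis coset_join2 subgroup.mem_carrier)
    then show "x \<in> S" using \<open>x \<in> N\<close> N(2) subgroup.one_closed[OF P(1)] by (auto simp: S_def)
  qed
  moreover have SA: "S \<subseteq> A" by (auto simp: S_def)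
  ultimately have "card (cosets G A N) = card (cosets G A S) * card P"
    using cosets_tower[OF assms(1) S N(1) _ _ assms(3)] by simp
  then have "card P * r = card P * card (cosets G A S)"
    using r(1) P(2) ord by (simp add: mult.commute)
  moreover have "card P \<noteq> 0" using P(2) assms(4) by (simp add: prime_gt_0_nat)
  ultimately have "r = card (cosets G A S)" by simp
  with r(2) show thesis
    using S \<open>N \<subseteq> S\<close> SA P(2) \<open>cosets G S N = P\<close> that by blast
qed

lemma cauchy:
  assumes "finite (carrier G)" "prime q" "q dvd order G"
  obtains z where "z \<in> carrier G" "z \<noteq> \<one>" "z [^] q = \<one>"
proof -
  \<comment> \<open>\<open>sylow_thm\<close> yields a subgroup of order \<open>q ^ a\<close> for
    every such power dividing the order; exponent 1 is enough here.\<close>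
  obtain m where "order G = q ^ 1 * m" using assms(3) by auto
  then obtain H where H: "subgroup H G" "card H = q ^ 1"
    using sylow_thm[OF assms(2) is_group _ assms(1)] by blast
  interpret H: group "G\<lparr>carrier := H\<rparr>" using H(1) by (rule subgroup_imp_group)
  have "H \<noteq> {\<one>}" using H(2) prime_gt_1_nat[OF assms(2)] by auto
  moreover have "\<one> \<in> H" using H(1) by (rule subgroup.one_closed)
  ultimately obtain z where z: "z \<in> H" "z \<noteq> \<one>" by auto
  have "z [^] card H = \<one>"
    using H.pow_order_eq_1[of z] z(1) by (simp add: order_def nat_pow_consistent[symmetric])
  then show thesis using that[of z] z H(2) subgroup.mem_carrier[OF H(1)] by simp
qed

text \<open>Subgroups between a maximal normal subgroup \<open>B\<close> and \<open>A\<close> are cut down by the terms of the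
  chain, and \<open>(A \<inter> M) B\<close> is either \<open>A\<close> or \<open>B\<close> as long as it is normal in \<open>A\<close>; the step where it
  jumps from \<open>A\<close> to \<open>B\<close> bounds the index.\<close>

lemma chain_simple_factor:
  assumes "subnormal_chain G m X M" "subgroup A G" "A \<subseteq> X" "B \<lhd> G\<lparr>carrier := A\<rparr>" "M \<subseteq> B" "A \<noteq> B"
    and simple: "\<And>C. C \<lhd> G\<lparr>carrier := A\<rparr> \<Longrightarrow> B \<subseteq> C \<Longrightarrow> C = A \<or> C = B"
  shows "finite (cosets G A B)" "card (cosets G A B) \<le> m"
proof -
  have B: "subgroup B G" "B \<subseteq> A" and nB: "\<And>a b. a \<in> A \<Longrightarrow> b \<in> B \<Longrightarrow> a \<otimes> b \<otimes> inv a \<in> B"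
    using assms(2,4) by (auto simp: normal_carrier_iff)
  note mem = subgroup.mem_carrier[OF assms(2)] subgroup.mem_carrier[OF B(1)]
  note Acl = subgroup.m_closed[OF assms(2)] subgroup.m_inv_closed[OF assms(2)]
  note Bcl = subgroup.m_closed[OF B(1)] subgroup.m_inv_closed[OF B(1)]
  \<comment> \<open>Invariant at a term \<open>D\<close> of the chain: the bound is already
    established, or \<open>A \<inter> D\<close> still covers \<open>A\<close> modulo
    \<open>B\<close>. The final term \<open>M \<subseteq> B\<close> rules out the second
    alternative.\<close>
  have "finite (cosets G A B) \<and> card (cosets G A B) \<le> m \<or> A \<subseteq> B <#> (A \<inter> M)"
    using assms(1,3)
  proof induction
    case refl
    have "a \<in> B <#> (A \<inter> X)" if "a \<in> A" for a
      using that refl.prems subgroup.one_closed[OF B(1)] mem by (force simp: set_mult_def)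
    then show ?case by blast
  next
    case (step D E)
    show ?case
    proof (cases "A \<subseteq> B <#> (A \<inter> D)")
      case False
      then show ?thesis using step by blast
    next
      case True
      have D: "subgroup D G" using step.hyps chainD by blast
      then have E: "subgroup E G" "E \<subseteq> D" and nE: "\<And>a b. a \<in> D \<Longrightarrow> b \<in> E \<Longrightarrow> a \<otimes> b \<otimes> inv a \<in> E"
        using step.hyps normal_carrier_iff[of D E] by auto
      note Ecl = subgroup.m_closed[OF E(1)] subgroup.m_inv_closed[OF E(1)]
      define C where "C = B <#> (A \<inter> E)"
      have memC: "x \<in> C \<longleftrightarrow> (\<exists>b\<in>B. \<exists>e\<in>A \<inter> E. x = b \<otimes> e)" for x
        by (auto simp: C_def set_mult_def)
      have conj: "d \<otimes> e \<otimes> inv d \<in> A \<inter> E" if "d \<in> A \<inter> D" "e \<in> A \<inter> E" for d e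
        using that nE[of d e] Acl by auto
      have CA: "C \<subseteq> A" using B(2) Acl by (auto simp: C_def set_mult_def)
      have BC: "B \<subseteq> C"
      proof
        fix b assume b: "b \<in> B"
        have "\<one> \<in> A \<inter> E" using assms(2) E(1) by (simp add: subgroup.one_closed)
        then show "b \<in> C" using b mem(2)[OF b] unfolding memC by force
      qed
      have C: "subgroup C G"
      proof (rule subgroupI)
        show "C \<subseteq> carrier G" using CA mem by blast
        show "C \<noteq> {}" using BC subgroup.one_closed[OF B(1)] by blast
      next
        fix x assume "x \<in> C"
        then obtain b e where x: "b \<in> B" "e \<in> A" "e \<in> E" "x = b \<otimes> e" using memC by auto
        have "inv e \<otimes> inv b \<otimes> inv (inv e) \<in> B" by (rule nB) (use x Acl Bcl in auto)
        moreover have "inv e \<in> A \<inter> E" using x Acl Ecl by blast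
        moreover have "inv x = (inv e \<otimes> inv b \<otimes> inv (inv e)) \<otimes> inv e"
          using x mem by (simp add: inv_mult_group m_assoc)
        ultimately show "inv x \<in> C" using memC by blast
      next
        fix x x' assume "x \<in> C" "x' \<in> C"
        then obtain b e b' e' where x: "b \<in> B" "e \<in> A" "e \<in> E" "x = b \<otimes> e"
            "b' \<in> B" "e' \<in> A" "e' \<in> E" "x' = b' \<otimes> e'" using memC by auto
        have "b \<otimes> (e \<otimes> b' \<otimes> inv e) \<in> B" using x(1) nB[OF x(2,5)] Bcl by simp
        moreover have "e \<otimes> e' \<in> A \<inter> E" using x Acl Ecl by blast
        moreover have "x \<otimes> x' = (b \<otimes> (e \<otimes> b' \<otimes> inv e)) \<otimes> (e \<otimes> e')"
          using x mem by (simp add: m_assoc inv_solve_left)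
        ultimately show "x \<otimes> x' \<in> C" using memC by blast
      qed
      have "C \<lhd> G\<lparr>carrier := A\<rparr>"
      proof (rule normal_carrierI[OF assms(2) C CA])
        fix a c assume "a \<in> A" "c \<in> C"
        from \<open>a \<in> A\<close> obtain b d where a: "b \<in> B" "d \<in> A" "d \<in> D" "a = b \<otimes> d"
          using True by (auto simp: set_mult_def)
        from \<open>c \<in> C\<close> obtain b' e where c: "b' \<in> B" "e \<in> A" "e \<in> E" "c = b' \<otimes> e"
          using memC by auto
        have "a \<otimes> b' \<otimes> inv a \<in> C" using nB[OF \<open>a \<in> A\<close> c(1)] BC by blast
        moreover have "b \<in> C" "inv b \<in> C" using a(1) Bcl BC by auto
        moreover have "d \<otimes> e \<otimes> inv d \<in> C"
        proof -
          have "d \<otimes> e \<otimes> inv d \<in> A \<inter> E" using conj a c by simp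
          moreover have "d \<otimes> e \<otimes> inv d = \<one> \<otimes> (d \<otimes> e \<otimes> inv d)" using a c mem by simp
          ultimately show ?thesis using memC subgroup.one_closed[OF B(1)] by blast
        qed
        \<comment> \<open>With \<open>a = b \<otimes> d\<close>, conjugation by \<open>d\<close>
          preserves \<open>A \<inter> E\<close>, while \<open>b\<close> and its inverse belong to
          \<open>C\<close>; so the conjugate of \<open>e\<close> by \<open>a\<close> is a product of
          elements of \<open>C\<close>.\<close>
        ultimately have "(a \<otimes> b' \<otimes> inv a) \<otimes> (b \<otimes> (d \<otimes> e \<otimes> inv d) \<otimes> inv b) \<in> C"
          using subgroup.m_closed[OF C] by blast
        moreover have "(a \<otimes> b' \<otimes> inv a) \<otimes> (b \<otimes> (d \<otimes> e \<otimes> inv d) \<otimes> inv b) = a \<otimes> c \<otimes> inv a"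
          using a c mem by (simp add: m_assoc inv_mult_group inv_cancel)
        ultimately show "a \<otimes> c \<otimes> inv a \<in> C" by simp
      qed
      then consider "C = A" | "C = B" using simple BC by blast
      then show ?thesis
      proof cases
        case 1
        then show ?thesis by (simp add: C_def)
      next
        case 2
        \<comment> \<open>This is the jump: \<open>A \<inter> D\<close> meets every coset of
          \<open>B\<close> in \<open>A\<close>, and elements of it that agree modulo
          \<open>E\<close> now agree modulo \<open>B\<close>, so
          \<open>|A : B| \<le> |D : E|\<close>.\<close>
        have AE: "A \<inter> E \<subseteq> B"
          using 2 memC subgroup.one_closed[OF B(1)] mem by (metis IntD1 l_one subsetI)
        have AD: "cosets G A B = (\<lambda>x. B #> x) ` (A \<inter> D)"
        proof
          show "cosets G A B \<subseteq> (\<lambda>x. B #> x) ` (A \<inter> D)"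
          proof
            fix c assume "c \<in> cosets G A B"
            then obtain a where "a \<in> A" "c = B #> a" by (auto simp: cosets_def)
            moreover from \<open>a \<in> A\<close> obtain b d where a: "b \<in> B" "d \<in> A" "d \<in> D" "a = b \<otimes> d"
              using True by (auto simp: set_mult_def)
            ultimately have "c = B #> d"
              using mem B(1) by (simp add: rcos_eq_iff m_assoc)
            then show "c \<in> (\<lambda>x. B #> x) ` (A \<inter> D)" using a by blast
          qed
        qed (auto simp: cosets_def)
        have *: "B #> x = B #> y" if "x \<in> A \<inter> D" "y \<in> A \<inter> D" "E #> x = E #> y" for x y
        proof -
          have "x \<otimes> inv y \<in> E" using that mem E by (simp add: rcos_eq_iff)
          moreover have "x \<otimes> inv y \<in> A" using that Acl by blast
          ultimately show ?thesis using AE that mem B by (auto simp: rcos_eq_iff)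
        qed
        have fin: "finite ((\<lambda>x. E #> x) ` (A \<inter> D))"
          using step.hyps(3) by (rule finite_subset[rotated]) (auto simp: cosets_def)
        have "card ((\<lambda>x. E #> x) ` (A \<inter> D)) \<le> card (cosets G D E)"
          using step.hyps(3) by (rule card_mono) (auto simp: cosets_def)
        also have "\<dots> \<le> m" by (rule step.hyps(4))
        finally show ?thesis
          using card_image_factor[of "\<lambda>x. E #> x" "A \<inter> D" "\<lambda>x. B #> x", OF fin *]
          unfolding AD by (meson order_trans)
      qed
    qed
  qed
  moreover have "\<not> A \<subseteq> B <#> (A \<inter> M)"
  proof
    assume "A \<subseteq> B <#> (A \<inter> M)"
    moreover have "B <#> (A \<inter> M) \<subseteq> B" using assms(5) Bcl by (auto simp: set_mult_def)
    ultimately show False using assms(6) B(2) by blast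
  qed
  ultimately show "finite (cosets G A B)" "card (cosets G A B) \<le> m" by auto
qed

end

section \<open>Topological groups\<close>

text \<open>The complements of the members together with \<open>O'\<close> cover \<open>X\<close>.
  Finitely many of them suffice, and closure under intersection puts a single member below finitely
  many.\<close>

lemma compactin_directed_Inter:
  assumes "compactin T X" "\<M> \<noteq> {}" "\<And>M. M \<in> \<M> \<Longrightarrow> closedin T M"
    and "\<And>M M'. M \<in> \<M> \<Longrightarrow> M' \<in> \<M> \<Longrightarrow> M \<inter> M' \<in> \<M>"
    and "openin T O'" "X \<inter> \<Inter>\<M> \<subseteq> O'"
  obtains M where "M \<in> \<M>" "X \<inter> M \<subseteq> O'"
proof -
  have X: "X \<subseteq> topspace T" using assms(1) by (rule compactin_subset_topspace)
  have "\<exists>\<F>. finite \<F> \<and> \<F> \<subseteq> insert O' ((\<lambda>M. topspace T - M) ` \<M>) \<and> X \<subseteq> \<Union>\<F>"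
  proof -
    have "\<forall>A\<in>insert O' ((\<lambda>M. topspace T - M) ` \<M>). openin T A"
      using assms(3,5) by (auto simp: closedin_def)
    moreover have "X \<subseteq> \<Union>(insert O' ((\<lambda>M. topspace T - M) ` \<M>))" using assms(6) X by auto
    ultimately show ?thesis using assms(1) unfolding compactin_def by meson
  qed
  then obtain \<F> where \<F>: "finite \<F>" "\<F> \<subseteq> insert O' ((\<lambda>M. topspace T - M) ` \<M>)" "X \<subseteq> \<Union>\<F>"
    by blast
  then have "finite (\<F> - {O'})" "\<F> - {O'} \<subseteq> (\<lambda>M. topspace T - M) ` \<M>" by auto
  then obtain \<N> where \<N>: "finite \<N>" "\<N> \<subseteq> \<M>" "\<F> - {O'} = (\<lambda>M. topspace T - M) ` \<N>"
    by (meson finite_subset_image)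
  have "\<exists>M\<in>\<M>. M \<subseteq> \<Inter>\<N>"
    using \<N>(1,2)
  proof induction
    case empty
    then show ?case using assms(2) by auto
  next
    case (insert N \<N>)
    then obtain M where "M \<in> \<M>" "M \<subseteq> \<Inter>\<N>" by auto
    then show ?case using assms(4)[of N M] insert.prems by (intro bexI[of _ "N \<inter> M"]) auto
  qed
  then obtain M where "M \<in> \<M>" "M \<subseteq> \<Inter>\<N>" by blast
  moreover have "X \<inter> \<Inter>\<N> \<subseteq> O'" using \<F>(3) \<N>(3) by blast
  ultimately show thesis using that[of M] by blast
qed

text \<open>The tube lemma, in the form that projection along a compact factor is a closed map: the
  complement of the set is the projection of the closed set on which \<open>f\<close> leaves
  \<open>O'\<close>.\<close>

lemma openin_compact_forall:
  assumes "compactin S D" "continuous_map (prod_topology S T) R f" "openin R O'"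
  shows "openin T {x \<in> topspace T. \<forall>c\<in>D. f (c, x) \<in> O'}"
proof -
  let ?P = "prod_topology (subtopology S D) T"
  have D: "D \<subseteq> topspace S" using assms(1) by (rule compactin_subset_topspace)
  have "continuous_map ?P R f"
    using assms(2) by (simp add: prod_topology_subtopology continuous_map_from_subtopology)
  then have "closedin ?P {z \<in> topspace ?P. f z \<in> topspace R - O'}"
    using assms(3) by (intro closedin_continuous_map_preimage) auto
  moreover have "closed_map ?P T snd"
    using assms(1) by (intro closed_map_snd) (simp add: compact_space_subtopology)
  ultimately have "openin T (topspace T - snd ` {z \<in> topspace ?P. f z \<in> topspace R - O'})"
    unfolding closed_map_def by (intro openin_diff openin_topspace) blast
  moreover have "topspace T - snd ` {z \<in> topspace ?P. f z \<in> topspace R - O'}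
      = {x \<in> topspace T. \<forall>c\<in>D. f (c, x) \<in> O'}"
    using D continuous_map_image_subset_topspace[OF assms(2)] by (force simp: image_subset_iff)
  ultimately show ?thesis by simp
qed

lemma Hausdorff_totally_disconnectedI:
  assumes "\<And>x y. x \<in> topspace T \<Longrightarrow> y \<in> topspace T \<Longrightarrow> x \<noteq> y \<Longrightarrow>
    \<exists>A. openin T A \<and> closedin T A \<and> x \<in> A \<and> y \<notin> A"
  shows "Hausdorff_space T" "totally_disconnected_space T"
proof -
  show "Hausdorff_space T"
    unfolding Hausdorff_space_def
  proof (intro allI impI)
    fix x y assume "x \<in> topspace T \<and> y \<in> topspace T \<and> x \<noteq> y"
    then obtain A where "openin T A" "closedin T A" "x \<in> A" "y \<notin> A" "y \<in> topspace T"
      using assms by meson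
    then show "\<exists>U V. openin T U \<and> openin T V \<and> x \<in> U \<and> y \<in> V \<and> disjnt U V"
      by (intro exI[of _ A] exI[of _ "topspace T - A"]) (auto simp: disjnt_def closedin_def)
  qed
  show "totally_disconnected_space T"
    unfolding totally_disconnected_space_def
  proof
    fix x assume x: "x \<in> topspace T"
    have "y = x" if "connected_component_of T x y" for y
    proof (rule ccontr)
      assume "y \<noteq> x"
      have y: "y \<in> topspace T" using that connected_component_in_topspace by metis
      then obtain A where "openin T A" "closedin T A" "x \<in> A" "y \<notin> A"
        using assms[OF x y] \<open>y \<noteq> x\<close> by auto
      moreover have "quasi_component_of T x y" using that by (rule connected_imp_quasi_component_of)
      ultimately show False by (auto simp: quasi_component_of_def)
    qed
    then show "connected_component_of_set T x = {x}"
      using x by (auto simp: connected_component_of_refl)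
  qed
qed

lemma totally_disconnected_space_subtopology:
  assumes "totally_disconnected_space T"
  shows "totally_disconnected_space (subtopology T S)"
  unfolding totally_disconnected_space_def
proof
  fix x assume x: "x \<in> topspace (subtopology T S)"
  have "y = x" if "connected_component_of (subtopology T S) x y" for y
  proof -
    have "connected_component_of T x y"
      using that by (auto simp: connected_component_of_def connectedin_subtopology)
    then show ?thesis using assms x by (auto simp: totally_disconnected_space_def)
  qed
  then show "connected_component_of_set (subtopology T S) x = {x}"
    using x by (auto simp: connected_component_of_refl)
qed

section \<open>Open and compact subgroups; pro-groups tested on elements\<close>

context topological_group
begin

lemma topspace [simp]: "topspace T = carrier G"
  by (rule topspace_eq_carrier)

lemma continuous_map_mult:
  assumes "continuous_map X T f" "continuous_map X T g"
  shows "continuous_map X T (\<lambda>x. f x \<otimes> g x)"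
proof -
  have "continuous_map X (prod_topology T T) (\<lambda>x. (f x, g x))"
    using assms by (simp add: continuous_map_pairedI)
  from continuous_map_compose[OF this continuous_mult] show ?thesis by (simp add: o_def)
qed

lemma continuous_map_inv:
  assumes "continuous_map X T f"
  shows "continuous_map X T (\<lambda>x. inv (f x))"
  using continuous_map_compose[OF assms continuous_inv] by (simp add: o_def)

lemma openin_preimage:
  assumes "continuous_map T T f" "openin T A"
  shows "openin T {x \<in> carrier G. f x \<in> A}"
  using openin_continuous_map_preimage[OF assms] by simp

lemma openin_lmult:
  assumes "openin T A" "a \<in> carrier G"
  shows "openin T {x \<in> carrier G. a \<otimes> x \<in> A}"
  using assms by (intro openin_preimage continuous_map_mult) auto

lemma openin_rmult:
  assumes "openin T A" "a \<in> carrier G"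
  shows "openin T {x \<in> carrier G. x \<otimes> a \<in> A}"
  using assms by (intro openin_preimage continuous_map_mult) auto

lemma open_subgroupI:
  assumes "subgroup H G" "openin T A" "\<one> \<in> A" "A \<subseteq> H"
  shows "openin T H"
proof (subst openin_subopen, intro ballI)
  fix h assume h: "h \<in> H"
  note hc = subgroup.mem_carrier[OF assms(1)]
  have "{x \<in> carrier G. inv h \<otimes> x \<in> A} \<subseteq> H"
  proof
    fix x assume x: "x \<in> {x \<in> carrier G. inv h \<otimes> x \<in> A}"
    then have "h \<otimes> (inv h \<otimes> x) \<in> H" using assms h subgroup.m_closed[OF assms(1)] by blast
    then show "x \<in> H" using x h hc by (simp add: inv_cancel)
  qed
  then show "\<exists>A. openin T A \<and> h \<in> A \<and> A \<subseteq> H"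
    using openin_lmult[OF assms(2), of "inv h"] assms(3) h hc
    by (intro exI[of _ "{x \<in> carrier G. inv h \<otimes> x \<in> A}"]) auto
qed

lemma rcos_eq_preimage:
  assumes "subgroup H G" "a \<in> carrier G"
  shows "H #> a = {x \<in> carrier G. x \<otimes> inv a \<in> H}"
  using subgroup.rcos_module[OF assms(1) is_group assms(2)]
    subgroup.elemrcos_carrier[OF assms(1) is_group assms(2)] by blast

lemma open_rcos:
  assumes "subgroup H G" "openin T H" "a \<in> carrier G"
  shows "openin T (H #> a)"
  using openin_rmult[OF assms(2), of "inv a"] assms rcos_eq_preimage by simp

lemma open_subgroup_closed:
  assumes "subgroup H G" "openin T H"
  shows "closedin T H"
proof -
  note mem = subgroup.mem_carrier[OF assms(1)]
  have "carrier G - H = (\<Union>a\<in>carrier G - H. H #> a)"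
  proof (intro equalityI subsetI)
    fix x assume "x \<in> carrier G - H"
    then show "x \<in> (\<Union>a\<in>carrier G - H. H #> a)" using rcos_self[OF _ assms(1)] by blast
  next
    fix x assume "x \<in> (\<Union>a\<in>carrier G - H. H #> a)"
    then obtain a h where a: "a \<in> carrier G" "a \<notin> H" "h \<in> H" "x = h \<otimes> a" by (auto simp: r_coset_def)
    have "a \<in> H" if "x \<in> H"
    proof -
      have "inv h \<otimes> x \<in> H"
        using that a subgroup.m_closed[OF assms(1)] subgroup.m_inv_closed[OF assms(1)] by blast
      then show ?thesis using a mem by (simp add: inv_cancel)
    qed
    then show "x \<in> carrier G - H" using a mem by auto
  qed
  moreover have "openin T (\<Union>a\<in>carrier G - H. H #> a)"
    using open_rcos[OF assms] by blast
  ultimately show ?thesis using openin_subset[OF assms(2)] by (simp add: closedin_def)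
qed

lemma closed_rcos:
  assumes "subgroup H G" "openin T H" "a \<in> carrier G"
  shows "closedin T (H #> a)"
proof -
  have "continuous_map T T (\<lambda>x. x \<otimes> inv a)"
    using assms(3) by (intro continuous_map_mult) auto
  from closedin_continuous_map_preimage[OF this open_subgroup_closed[OF assms(1,2)]] show ?thesis
    using assms rcos_eq_preimage by simp
qed

lemma finite_cosets:
  assumes "subgroup B G" "openin T B" "compactin T A"
  shows "finite (cosets G A B)"
proof -
  have A: "A \<subseteq> carrier G" using compactin_subset_topspace[OF assms(3)] by simp
  have "A \<subseteq> \<Union>(cosets G A B)" using A rcos_self[OF _ assms(1)] by (auto simp: cosets_def)
  moreover have "\<forall>c\<in>cosets G A B. openin T c" using A open_rcos[OF assms(1,2)] by (auto simp: cosets_def)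
  ultimately obtain \<F> where \<F>: "finite \<F>" "\<F> \<subseteq> cosets G A B" "A \<subseteq> \<Union>\<F>"
    using assms(3) unfolding compactin_def by meson
  have "cosets G A B \<subseteq> \<F>"
  proof
    fix c assume "c \<in> cosets G A B"
    then obtain a where a: "a \<in> A" "c = B #> a" by (auto simp: cosets_def)
    then obtain d where d: "a \<in> d" "d \<in> \<F>" using \<F>(3) by blast
    then obtain a' where a': "a' \<in> A" "d = B #> a'" using \<F>(2) by (auto simp: cosets_def)
    then have "B #> a' = B #> a" using repr_independence[of a B a'] assms(1) A d by blast
    then show "c \<in> \<F>" using a a' d by simp
  qed
  then show ?thesis using \<F>(1) finite_subset by blast
qed

text \<open>Compactness of \<open>D\<close> keeps an infinite intersection of conjugates open. This
  is how compact generation makes every \<open>W n\<close> open.\<close>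

lemma openin_conj_compact:
  assumes "compactin T D" "openin T A"
  shows "openin T {x \<in> carrier G. \<forall>c\<in>D. inv c \<otimes> x \<otimes> c \<in> A}"
proof -
  have "continuous_map (prod_topology T T) T (\<lambda>z. inv (fst z) \<otimes> snd z \<otimes> fst z)"
    by (intro continuous_map_mult continuous_map_inv continuous_map_fst continuous_map_snd)
  from openin_compact_forall[OF assms(1) this assms(2)] show ?thesis by simp
qed

lemma subgroup_conj_Inter:
  assumes "subgroup U G" "D \<subseteq> carrier G"
  shows "subgroup {x \<in> carrier G. \<forall>c\<in>D. inv c \<otimes> x \<otimes> c \<in> U} G"
proof (rule subgroupI)
  have "inv c \<otimes> \<one> \<otimes> c \<in> U" if "c \<in> D" for c
    using that assms subgroup.one_closed[OF assms(1)] by (simp add: subset_iff)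
  then show "{x \<in> carrier G. \<forall>c\<in>D. inv c \<otimes> x \<otimes> c \<in> U} \<noteq> {}" by blast
next
  fix x assume x: "x \<in> {x \<in> carrier G. \<forall>c\<in>D. inv c \<otimes> x \<otimes> c \<in> U}"
  have "inv c \<otimes> inv x \<otimes> c \<in> U" if "c \<in> D" for c
  proof -
    have c: "c \<in> carrier G" using that assms(2) by blast
    have "inv (inv c \<otimes> x \<otimes> c) \<in> U" using x that subgroup.m_inv_closed[OF assms(1)] by blast
    then show ?thesis using x c by (simp add: inv_mult_group m_assoc)
  qed
  then show "inv x \<in> {x \<in> carrier G. \<forall>c\<in>D. inv c \<otimes> x \<otimes> c \<in> U}" using x by simp
next
  fix x y assume x: "x \<in> {x \<in> carrier G. \<forall>c\<in>D. inv c \<otimes> x \<otimes> c \<in> U}"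
    and y: "y \<in> {x \<in> carrier G. \<forall>c\<in>D. inv c \<otimes> x \<otimes> c \<in> U}"
  have "inv c \<otimes> (x \<otimes> y) \<otimes> c \<in> U" if "c \<in> D" for c
  proof -
    have c: "c \<in> carrier G" using that assms(2) by blast
    have "(inv c \<otimes> x \<otimes> c) \<otimes> (inv c \<otimes> y \<otimes> c) \<in> U"
      using x y that subgroup.m_closed[OF assms(1)] by blast
    then show ?thesis using x y c by (simp add: m_assoc inv_cancel)
  qed
  then show "x \<otimes> y \<in> {x \<in> carrier G. \<forall>c\<in>D. inv c \<otimes> x \<otimes> c \<in> U}" using x y by simp
qed auto

text \<open>\<open>V\<close> is compact but possibly not open, since pro-\<open>p\<close> subgroups
  are also treated this way. The open set \<open>A\<close> is returned on its own so that
  \<open>A \<inter> V\<close> is visibly relatively open.\<close>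

lemma open_normal_core:
  assumes "subgroup V G" "compactin T V" "subgroup U G" "openin T U"
  obtains A where "openin T A" "\<one> \<in> A" "A \<inter> V \<subseteq> U" "A \<inter> V \<lhd> G\<lparr>carrier := V\<rparr>"
proof
  let ?A = "{x \<in> carrier G. \<forall>c\<in>V. inv c \<otimes> x \<otimes> c \<in> U}"
  have V: "V \<subseteq> carrier G" using subgroup.subset[OF assms(1)] .
  have A: "subgroup ?A G" using subgroup_conj_Inter[OF assms(3) V] .
  show "openin T ?A" using openin_conj_compact[OF assms(2,4)] .
  show "\<one> \<in> ?A" using subgroup.one_closed[OF A] .
  show "?A \<inter> V \<subseteq> U" using subgroup.one_closed[OF assms(1)] V by force
  show "?A \<inter> V \<lhd> G\<lparr>carrier := V\<rparr>"
  proof (rule normal_carrierI)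
    show "subgroup (?A \<inter> V) G" using subgroups_Inter_pair[OF A assms(1)] .
    fix a b assume a: "a \<in> V" and b: "b \<in> ?A \<inter> V"
    have "inv c \<otimes> (a \<otimes> b \<otimes> inv a) \<otimes> c \<in> U" if c: "c \<in> V" for c
    proof -
      have m: "a \<in> carrier G" "b \<in> carrier G" "c \<in> carrier G" using a b c V by auto
      have "inv a \<otimes> c \<in> V" using a c subgroup.m_closed[OF assms(1)] subgroup.m_inv_closed[OF assms(1)] by simp
      then have "inv (inv a \<otimes> c) \<otimes> b \<otimes> (inv a \<otimes> c) \<in> U" using b by blast
      then show ?thesis using m by (simp add: m_assoc inv_mult_group)
    qed
    moreover have "a \<otimes> b \<otimes> inv a \<in> V"
      using a b subgroup.m_closed[OF assms(1)] subgroup.m_inv_closed[OF assms(1)] by simp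
    ultimately show "a \<otimes> b \<otimes> inv a \<in> ?A \<inter> V" using V by auto
  qed (use assms(1) in auto)
qed

lemma topological_subgroup:
  assumes "subgroup S G"
  shows "topological_group (G\<lparr>carrier := S\<rparr>) (subtopology T S)"
proof -
  have S: "S \<subseteq> carrier G" using subgroup.subset[OF assms] .
  interpret S: group "G\<lparr>carrier := S\<rparr>" using assms by (rule subgroup_imp_group)
  have "continuous_map (prod_topology (subtopology T S) (subtopology T S)) (subtopology T S)
      (\<lambda>(x, y). x \<otimes> y)"
    unfolding prod_topology_subtopology subtopology_subtopology[symmetric] continuous_map_in_subtopology
    using continuous_mult subgroup.m_closed[OF assms]
    by (auto simp: continuous_map_from_subtopology subtopology_subtopology)
  moreover have "continuous_map (subtopology T S) (subtopology T S) (\<lambda>x. inv x)"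
    unfolding continuous_map_in_subtopology
    using continuous_inv subgroup.m_inv_closed[OF assms]
    by (auto simp: continuous_map_from_subtopology)
  then have "continuous_map (subtopology T S) (subtopology T S) (\<lambda>x. inv\<^bsub>G\<lparr>carrier := S\<rparr>\<^esub> x)"
    by (rule continuous_map_eq) (use assms in \<open>auto simp: m_inv_consistent\<close>)
  ultimately show ?thesis using S by unfold_locales auto
qed

lemma profinite_subgroup:
  assumes "subgroup S G" "compactin T S" "Hausdorff_space T" "totally_disconnected_space T"
  shows "profinite_group (G\<lparr>carrier := S\<rparr>) (subtopology T S)"
  using assms
  by (simp add: profinite_group_def topological_subgroup compact_space_subtopology
      Hausdorff_space_subtopology totally_disconnected_space_subtopology)

text \<open>By Cauchy's theorem it suffices to look at single elements.\<close>

lemma pro_groupI: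
  assumes "profinite_group (G\<lparr>carrier := S\<rparr>) (subtopology T S)" "subgroup S G"
    and pow: "\<And>q x A. prime q \<Longrightarrow> q \<notin> \<pi> \<Longrightarrow> x \<in> S \<Longrightarrow> openin T A \<Longrightarrow> \<one> \<in> A \<Longrightarrow>
      \<exists>a. \<not> q dvd a \<and> x [^] (a::nat) \<in> A"
  shows "pro_group \<pi> (G\<lparr>carrier := S\<rparr>) (subtopology T S)"
  unfolding pro_group_def
proof (intro conjI ballI allI impI)
  fix Q q assume "Q \<in> finite_continuous_quotients (G\<lparr>carrier := S\<rparr>) (subtopology T S)"
    and q: "prime q \<and> q dvd order Q"
  then obtain N where N: "Q = G\<lparr>carrier := S\<rparr> Mod N" "N \<lhd> G\<lparr>carrier := S\<rparr>"
      "openin (subtopology T S) N" "finite (carrier Q)"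
    by (auto simp: finite_continuous_quotients_def)
  interpret Q: group Q unfolding N(1) using N(2) by (rule normal.factorgroup_is_group)
  have Ns: "subgroup N G" "N \<subseteq> S" using N(2) assms(2) by (auto simp: normal_carrier_iff)
  obtain A where A: "openin T A" "N = A \<inter> S" using N(3) by (auto simp: openin_subtopology)
  obtain z where z: "z \<in> carrier Q" "z \<noteq> \<one>\<^bsub>Q\<^esub>" "z [^]\<^bsub>Q\<^esub> q = \<one>\<^bsub>Q\<^esub>"
    using Q.cauchy[OF N(4)] q by blast
  obtain x where x: "x \<in> S" "z = N #> x"
    using z(1) by (auto simp: N(1) carrier_Mod_restrict cosets_def)
  show "q \<in> \<pi>"
  proof (rule ccontr)
    assume "q \<notin> \<pi>"
    then obtain a :: nat where a: "\<not> q dvd a" "x [^] a \<in> A"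
      using pow[of q x A] q x(1) A subgroup.one_closed[OF Ns(1)] by blast
    then have "x [^] a \<in> N" using A(2) subgroup_pow_mem[OF assms(2) x(1)] by blast
    then have "z [^]\<^bsub>Q\<^esub> a = \<one>\<^bsub>Q\<^esub>"
      using rcos_Mod_pow[OF assms(2) N(2) x(1)] x(2) Ns(1)
      by (simp add: N(1) coset_join2 subgroup.mem_carrier[OF Ns(1)])
    moreover have "coprime a q" using a(1) q prime_imp_coprime[of q a] by (simp add: coprime_commute)
    \<comment> \<open>\<open>coprime_pow_mem\<close> for the trivial subgroup: \<open>z\<close> is
      killed by the coprime exponents \<open>a\<close> and \<open>q\<close>.\<close>
    ultimately have "z \<in> {\<one>\<^bsub>Q\<^esub>}"
      using Q.coprime_pow_mem[OF Q.triv_subgroup z(1), of a q] z(3) by simp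
    then show False using z(2) by simp
  qed
qed (rule assms)

text \<open>The exponent is the order of a finite continuous quotient of \<open>S\<close> whose
  kernel lies in \<open>U\<close>, so only primes in \<open>\<pi>\<close> divide it.\<close>

lemma pro_group_pow:
  assumes "pro_group \<pi> (G\<lparr>carrier := S\<rparr>) (subtopology T S)" "subgroup S G"
    and "x \<in> S" "subgroup U G" "openin T U"
  obtains a :: nat where "\<And>q. prime q \<Longrightarrow> q dvd a \<Longrightarrow> q \<in> \<pi>" "x [^] a \<in> U"
proof -
  have S: "compactin T S"
    using assms(1,2) subgroup.subset[OF assms(2)]
    by (simp add: pro_group_def profinite_group_def compactin_subspace)
  obtain A where A: "openin T A" "\<one> \<in> A" "A \<inter> S \<subseteq> U" "A \<inter> S \<lhd> G\<lparr>carrier := S\<rparr>"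
    using open_normal_core[OF assms(2) S assms(4,5)] .
  let ?Q = "G\<lparr>carrier := S\<rparr> Mod (A \<inter> S)"
  have sub: "subgroup (A \<inter> S) G" using A(4) assms(2) by (simp add: normal_carrier_iff)
  \<comment> \<open>Computed inside the topological group \<open>S\<close>, because
    \<open>A \<inter> S\<close> is open in \<open>S\<close> but possibly not in
    \<open>G\<close>.\<close>
  have "finite (cosets G S (A \<inter> S))"
  proof -
    interpret S: topological_group "G\<lparr>carrier := S\<rparr>" "subtopology T S"
      using topological_subgroup[OF assms(2)] .
    have "compactin (subtopology T S) S" using S by (simp add: compactin_subtopology)
    moreover have "subgroup (A \<inter> S) (G\<lparr>carrier := S\<rparr>)" using A(4) by (simp add: normal_imp_subgroup)
    moreover have "openin (subtopology T S) (A \<inter> S)" using A(1) by (auto simp: openin_subtopology)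
    ultimately show ?thesis using S.finite_cosets[of "A \<inter> S" S] by (simp add: cosets_def)
  qed
  then have "?Q \<in> finite_continuous_quotients (G\<lparr>carrier := S\<rparr>) (subtopology T S)"
    using A by (auto simp: finite_continuous_quotients_def carrier_Mod_restrict openin_subtopology)
  then have "q \<in> \<pi>" if "prime q" "q dvd card (cosets G S (A \<inter> S))" for q
    using assms(1) that by (auto simp: pro_group_def order_def carrier_Mod_restrict)
  moreover have "x [^] card (cosets G S (A \<inter> S)) \<in> U"
    using pow_index_mem[OF assms(2) A(4) assms(3)] A(3) by blast
  ultimately show thesis using that by blast
qed

end

text \<open>The component of the identity is a point, hence compact, so a clopen set
  \<open>A\<close> contains it within a compact part of \<open>W\<close>. The elements that
  stabilise \<open>A\<close> under right multiplication form the subgroup: it lies in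
  \<open>A\<close> because the identity does, and it is open because \<open>A\<close> is both
  compact and open.\<close>

lemma van_dantzig:
  assumes "tdlc_group G T" "openin T W" "\<one>\<^bsub>G\<^esub> \<in> W"
  obtains U where "compact_open_subgroup U G T" "U \<subseteq> W"
proof -
  interpret topological_group G T using assms(1) by (simp add: tdlc_group_def)
  have T: "Hausdorff_space T" "locally_compact_space T" "totally_disconnected_space T"
    using assms(1) by (auto simp: tdlc_group_def)
  obtain O' L where L: "openin T O'" "compactin T L" "\<one>\<^bsub>G\<^esub> \<in> O'" "O' \<subseteq> L"
    using T(2)[unfolded locally_compact_space_def topspace, THEN bspec, OF one_closed] by auto
  have "{\<one>\<^bsub>G\<^esub>} \<in> connected_components_of T"
    using T(3) by (force simp: connected_components_of_def totally_disconnected_space_def)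
  moreover have "openin T (W \<inter> O')" using assms(2) L by blast
  ultimately obtain A B where A: "openin T A" "openin T B" "disjnt A B" "A \<union> B = topspace T"
      "{\<one>\<^bsub>G\<^esub>} \<subseteq> A" "A \<subseteq> W \<inter> O'"
    using wilder_locally_compact_component_thm[OF T(2,1), of "{\<one>\<^bsub>G\<^esub>}" "W \<inter> O'"] assms(3) L by auto
  have "A = topspace T - B" using A(3,4) by (auto simp: disjnt_def)
  then have "closedin T A" using closedin_diff[OF closedin_topspace A(2)] by simp
  moreover have "A \<subseteq> L" using L(4) A(6) by blast
  ultimately have cA: "compactin T A" using closed_compactin[OF L(2)] by blast
  have Ac: "A \<subseteq> carrier G" using A(4) by auto
  define U where "U = {x \<in> carrier G. \<forall>a\<in>A. a \<otimes>\<^bsub>G\<^esub> x \<in> A} \<inter> {x \<in> carrier G. \<forall>a\<in>A. a \<otimes>\<^bsub>G\<^esub> inv\<^bsub>G\<^esub> x \<in> A}"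
  have U: "subgroup U G"
  proof (rule subgroupI)
    have "\<one>\<^bsub>G\<^esub> \<in> U" using Ac by (simp add: U_def subset_iff)
    then show "U \<noteq> {}" by blast
    show "U \<subseteq> carrier G" by (auto simp: U_def)
    show "inv\<^bsub>G\<^esub> x \<in> U" if "x \<in> U" for x using that by (auto simp: U_def)
    fix x y assume x: "x \<in> U" and y: "y \<in> U"
    have "a \<otimes>\<^bsub>G\<^esub> (x \<otimes>\<^bsub>G\<^esub> y) \<in> A" "a \<otimes>\<^bsub>G\<^esub> inv\<^bsub>G\<^esub> (x \<otimes>\<^bsub>G\<^esub> y) \<in> A" if "a \<in> A" for a
    proof -
      have "a \<otimes>\<^bsub>G\<^esub> x \<otimes>\<^bsub>G\<^esub> y \<in> A" "a \<otimes>\<^bsub>G\<^esub> inv\<^bsub>G\<^esub> y \<otimes>\<^bsub>G\<^esub> inv\<^bsub>G\<^esub> x \<in> A" using that x y by (auto simp: U_def)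
      then show "a \<otimes>\<^bsub>G\<^esub> (x \<otimes>\<^bsub>G\<^esub> y) \<in> A" "a \<otimes>\<^bsub>G\<^esub> inv\<^bsub>G\<^esub> (x \<otimes>\<^bsub>G\<^esub> y) \<in> A"
        using that x y Ac by (auto simp: U_def m_assoc inv_mult_group subset_iff)
    qed
    then show "x \<otimes>\<^bsub>G\<^esub> y \<in> U" using x y by (auto simp: U_def)
  qed
  have "continuous_map (prod_topology T T) T (\<lambda>z. fst z \<otimes>\<^bsub>G\<^esub> snd z)"
    "continuous_map (prod_topology T T) T (\<lambda>z. fst z \<otimes>\<^bsub>G\<^esub> inv\<^bsub>G\<^esub> (snd z))"
    by (intro continuous_map_mult continuous_map_inv continuous_map_fst continuous_map_snd)+
  then have oU: "openin T U"
    using openin_compact_forall[OF cA _ A(1)] unfolding U_def by (intro openin_Int) fastforce+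
  have UA: "U \<subseteq> A"
  proof
    fix x assume "x \<in> U"
    then have "\<one>\<^bsub>G\<^esub> \<otimes>\<^bsub>G\<^esub> x \<in> A" "x \<in> carrier G" using A(5) unfolding U_def by blast+
    then show "x \<in> A" by simp
  qed
  have "compactin T U"
    using closed_compactin[OF cA UA open_subgroup_closed[OF U oU]] .
  then show thesis using that[of U] U oU UA A(6) by (auto simp: compact_open_subgroup_def)
qed

section \<open>Bounded composition factors\<close>

context group
begin

text \<open>Simplicity of \<open>A / B\<close> says that no normal subgroup of \<open>A\<close> lies
  strictly between \<open>B\<close> and \<open>A\<close>, which is what
  \<open>chain_simple_factor\<close> asks for. Each composition series is treated on its
  own.\<close>

lemma composition_factor_bound:
  assumes "subnormal_chain G m (carrier G) {\<one>}" "S \<in> composition_factors G"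
  shows "finite (carrier S)" "order S \<le> m"
proof -
  obtain Hs i where H: "composition_series G Hs" "Suc i < length Hs"
      "S = G\<lparr>carrier := Hs ! Suc i\<rparr> Mod Hs ! i"
    using assms(2) by (auto simp: composition_factors_def)
  define A B where "A = Hs ! Suc i" and "B = Hs ! i"
  have S: "S = G\<lparr>carrier := A\<rparr> Mod B" using H(3) by (simp add: A_def B_def)
  have A: "subgroup A G" and nB: "B \<lhd> G\<lparr>carrier := A\<rparr>" and "simple_group S"
    using H(1,2) unfolding S composition_series_def A_def B_def by auto
  interpret S: simple_group S by fact
  have B: "subgroup B G" "B \<subseteq> A" using A nB by (auto simp: normal_carrier_iff)
  note mem = subgroup.mem_carrier[OF A]
  have cS: "carrier S = cosets G A B" by (simp add: S carrier_Mod_restrict)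
  have B1: "B #> b = B" if "b \<in> B" for b
    using coset_join2[OF _ B(1) that] that subgroup.mem_carrier[OF B(1)] by simp
  have "cosets G A B = {B}" if "A = B"
    using B1 subgroup.one_closed[OF B(1)] that by (force simp: cosets_def)
  then have AB: "A \<noteq> B" using S.order_gt_one cS by (auto simp: order_def)
  have simple: "C = A \<or> C = B" if C: "C \<lhd> G\<lparr>carrier := A\<rparr>" "B \<subseteq> C" for C
  proof -
    have Cs: "subgroup C G" "C \<subseteq> A" using C(1) A by (auto simp: normal_carrier_iff)
    interpret h: group_hom "G\<lparr>carrier := A\<rparr>" S "\<lambda>a. B #> a"
      using normal.r_coset_hom_Mod[OF nB] subgroup_imp_group[OF A] S.is_group
      by (simp add: group_hom_def group_hom_axioms_def S)
    have "(\<lambda>a. B #> a) ` C \<lhd> S"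
      using normal.surj_hom_normal_subgroup[OF C(1) h.group_hom_axioms] cS by (simp add: cosets_def)
    then consider "(\<lambda>a. B #> a) ` C = cosets G A B" | "(\<lambda>a. B #> a) ` C = {B}"
      using S.no_real_normal_subgroup cS by (auto simp: S)
    then show ?thesis
    proof cases
      case 1
      have "a \<in> C" if a: "a \<in> A" for a
      proof -
        have "B #> a \<in> (\<lambda>a. B #> a) ` C" using 1 a by (auto simp: cosets_def)
        then obtain c where c: "c \<in> C" "B #> a = B #> c" by auto
        have "a \<otimes> inv c \<in> C" using c a mem Cs(2) B C(2) by (auto simp: rcos_eq_iff subset_iff)
        then have "a \<otimes> inv c \<otimes> c \<in> C" using c(1) subgroup.m_closed[OF Cs(1)] by blast
        then show ?thesis using a c mem Cs(2) by (simp add: m_assoc subset_iff)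
      qed
      then show ?thesis using Cs(2) by blast
    next
      case 2
      have "c \<in> B" if c: "c \<in> C" for c
      proof -
        have "B #> c = B" using 2 c by blast
        then show ?thesis using rcos_self[OF _ B(1), of c] c mem Cs(2) by blast
      qed
      then show ?thesis using C(2) by blast
    qed
  qed
  note * = chain_simple_factor[OF assms(1) A subgroup.subset[OF A] nB _ AB simple]
  have "{\<one>} \<subseteq> B" using subgroup.one_closed[OF B(1)] by simp
  then show "finite (carrier S)" "order S \<le> m" using * by (simp_all add: cS order_def)
qed

end

text \<open>A chain that ends inside the open normal subgroup \<open>N\<close> maps to a chain from
  all of \<open>V / N\<close> to the trivial group, with the same bound.\<close>

lemma (in topological_group) profinite_composition_factor_bound:
  assumes "subgroup V G" "\<And>A. openin T A \<Longrightarrow> \<one> \<in> A \<Longrightarrow> \<exists>M. subnormal_chain G m V M \<and> M \<subseteq> A"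
    and "S \<in> profinite_composition_factors (G\<lparr>carrier := V\<rparr>) (subtopology T V)"
  shows "finite (carrier S)" "order S \<le> m"
proof -
  obtain N where N: "N \<lhd> G\<lparr>carrier := V\<rparr>" "openin (subtopology T V) N"
      "S \<in> composition_factors (G\<lparr>carrier := V\<rparr> Mod N)"
    using assms(3) by (auto simp: profinite_composition_factors_def finite_continuous_quotients_def)
  let ?Q = "G\<lparr>carrier := V\<rparr> Mod N"
  obtain A where A: "openin T A" "N = A \<inter> V" using N(2) by (auto simp: openin_subtopology)
  have Ns: "subgroup N G" using N(1) assms(1) by (simp add: normal_carrier_iff)
  obtain M where M: "subnormal_chain G m V M" "M \<subseteq> A"
    using assms(2)[OF A(1)] A(2) subgroup.one_closed[OF Ns] by blast
  interpret h: group_hom "G\<lparr>carrier := V\<rparr>" ?Q "\<lambda>a. N #> a"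
    using normal.r_coset_hom_Mod[OF N(1)] normal.factorgroup_is_group[OF N(1)]
      subgroup_imp_group[OF assms(1)]
    by (simp add: group_hom_def group_hom_axioms_def)
  have "(\<lambda>a. N #> a) ` M = {N}"
  proof -
    have "N #> x = N" if "x \<in> M" for x
    proof -
      have "x \<in> N" using that M A(2) chainD(3)[OF M(1)] by blast
      then show ?thesis using coset_join2[OF _ Ns] subgroup.mem_carrier[OF Ns] by simp
    qed
    moreover have "\<one> \<in> M" using chainD(2)[OF M(1)] by (rule subgroup.one_closed)
    ultimately show ?thesis by force
  qed
  moreover have "(\<lambda>a. N #> a) ` V = carrier ?Q" by (simp add: carrier_Mod_restrict cosets_def)
  moreover note h.chain_hom[OF chain_restrict[OF M(1) assms(1) order_refl]]
  ultimately have "subnormal_chain ?Q m (carrier ?Q) {\<one>\<^bsub>?Q\<^esub>}" by simp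
  then show "finite (carrier S)" "order S \<le> m"
    using h.H.composition_factor_bound[OF _ N(3)] by blast+
qed

section \<open>Groups with a compact open subgroup of trivial core\<close>

text \<open>The situation of \<open>G / K\<close> with the image of \<open>U\<close>, seen as a
  group of its own. The trivial core takes the place of the Hausdorff and total disconnectedness
  conditions, which are derived through \<open>clopen_separation\<close>.\<close>

locale core_free_group = topological_group +
  fixes U C :: "'a set"
  assumes U: "compact_open_subgroup U G T"
    and C: "compactin T C" "generate G C = carrier G"
    and core_free: "\<And>x. x \<in> carrier G \<Longrightarrow> (\<And>g. g \<in> carrier G \<Longrightarrow> inv g \<otimes> x \<otimes> g \<in> U) \<Longrightarrow> x = \<one>"
begin

lemma U_subgroup: "subgroup U G" and U_compact: "compactin T U" and U_open: "openin T U"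
  using U by (auto simp: compact_open_subgroup_def)

lemmas U_mem = subgroup.mem_carrier[OF U_subgroup]

text \<open>Inverses are included so that every element of the group is a product of elements of
  \<open>D\<close>. The left factor \<open>U\<close> makes \<open>D\<close> invariant under left
  multiplication by \<open>U\<close>, whence the normality of \<open>W n\<close> in
  \<open>U\<close>.\<close>

definition D :: "'a set"
  where "D = (\<lambda>(x, y). x \<otimes> y) ` (U \<times> (C \<union> (\<lambda>x. inv x) ` C))"

text \<open>In the action on the coset space \<open>G / U\<close>, the group \<open>W n\<close> fixes the ball of radius \<open>n\<close>
  around the base point of the graph in which \<open>g U\<close> is joined to \<open>g d U\<close> for \<open>d \<in> D\<close>.\<close>

primrec W :: "nat \<Rightarrow> 'a set"
  where "W 0 = U"
  | "W (Suc n) = W n \<inter> {x \<in> carrier G. \<forall>c\<in>D. inv c \<otimes> x \<otimes> c \<in> W n}"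

lemma compact_D: "compactin T D"
proof -
  have "compactin T ((\<lambda>x. inv x) ` C)" using C(1) continuous_inv by (rule image_compactin)
  then have "compactin (prod_topology T T) (U \<times> (C \<union> (\<lambda>x. inv x) ` C))"
    using U_compact C(1) by (simp add: compactin_Times compactin_Un)
  then show ?thesis unfolding D_def using continuous_mult by (rule image_compactin)
qed

lemma D_carrier: "D \<subseteq> carrier G"
  using compactin_subset_topspace[OF compact_D] by simp

lemma U_mult_D: "u \<in> U \<Longrightarrow> d \<in> D \<Longrightarrow> u \<otimes> d \<in> D"
proof -
  assume u: "u \<in> U" and "d \<in> D"
  then obtain v c where d: "v \<in> U" "c \<in> C \<union> (\<lambda>x. inv x) ` C" "d = v \<otimes> c" by (auto simp: D_def)
  have "c \<in> carrier G" using d(2) compactin_subset_topspace[OF C(1)] by auto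
  then have "u \<otimes> d = (u \<otimes> v) \<otimes> c" using u d U_mem by (simp add: m_assoc)
  moreover have "u \<otimes> v \<in> U" using u d subgroup.m_closed[OF U_subgroup] by blast
  ultimately show ?thesis using d(2) unfolding D_def by force
qed

lemma C_D:
  assumes "c \<in> C"
  shows "c \<in> D" "inv c \<in> D"
proof -
  have "e \<in> D" if e: "e \<in> C \<union> (\<lambda>x. inv x) ` C" for e
  proof -
    have "e \<in> carrier G" using e compactin_subset_topspace[OF C(1)] by auto
    then have "e = (\<lambda>(x, y). x \<otimes> y) (\<one>, e)" by simp
    then show ?thesis using e subgroup.one_closed[OF U_subgroup] unfolding D_def by blast
  qed
  then show "c \<in> D" "inv c \<in> D" using assms by auto
qed

lemma generated_induct:
  assumes "P \<one>" and step: "\<And>g d. g \<in> carrier G \<Longrightarrow> d \<in> D \<Longrightarrow> P g \<Longrightarrow> P (g \<otimes> d)"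
    and "g \<in> carrier G"
  shows "P g"
proof -
  \<comment> \<open>Generalised over the starting point \<open>g\<close>, because a product
    \<open>h1 \<otimes> h2\<close> is handled by multiplying with \<open>h1\<close> and then with
    \<open>h2\<close>.\<close>
  have "\<forall>g\<in>carrier G. P g \<longrightarrow> P (g \<otimes> h)" if "h \<in> generate G C" for h
    using that
  proof induction
    case (eng h1 h2)
    then have "h1 \<in> carrier G" "h2 \<in> carrier G" using C(2) by auto
    then show ?case using eng.IH by (simp flip: m_assoc)
  qed (use step C_D in auto)
  then have "P (\<one> \<otimes> g)" using assms C(2) by blast
  then show ?thesis using assms(3) by simp
qed

lemma W_subgroup: "subgroup (W n) G"
proof (induction n)
  case (Suc n)
  then show ?case
    using subgroups_Inter_pair[OF Suc subgroup_conj_Inter[OF Suc D_carrier]] by simp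
qed (simp add: U_subgroup)

lemma W_open: "openin T (W n)"
  by (induction n) (simp_all add: U_open openin_conj_compact[OF compact_D] openin_Int)

lemma W_antimono: "i \<le> j \<Longrightarrow> W j \<subseteq> W i"
  by (rule lift_Suc_antimono_le[of W]) auto

lemma W_U: "W n \<subseteq> U"
  using W_antimono[of 0 n] by simp

text \<open>Membership in \<open>W (Suc n)\<close> is tested by conjugating with \<open>c\<close> in
  \<open>D\<close>. Conjugation by \<open>u\<close> replaces \<open>c\<close> by
  \<open>inv u \<otimes> c\<close>, which is again in \<open>D\<close>.\<close>

lemma W_conj: "u \<in> U \<Longrightarrow> w \<in> W n \<Longrightarrow> u \<otimes> w \<otimes> inv u \<in> W n"
proof (induction n arbitrary: w)
  case 0
  then show ?case
    using subgroup.m_closed[OF U_subgroup] subgroup.m_inv_closed[OF U_subgroup] by simp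
next
  case (Suc n)
  have mem: "u \<in> carrier G" "w \<in> carrier G" using Suc.prems U_mem by auto
  have "inv c \<otimes> (u \<otimes> w \<otimes> inv u) \<otimes> c \<in> W n" if c: "c \<in> D" for c
  proof -
    have "inv u \<otimes> c \<in> D" using c Suc.prems subgroup.m_inv_closed[OF U_subgroup] U_mult_D by blast
    then have "inv (inv u \<otimes> c) \<otimes> w \<otimes> (inv u \<otimes> c) \<in> W n" using Suc.prems by simp
    then show ?thesis using mem c D_carrier by (simp add: m_assoc inv_mult_group subset_iff)
  qed
  then show ?case using Suc mem by simp
qed

lemma W_normal: "W n \<lhd> G\<lparr>carrier := U\<rparr>"
  using W_conj by (intro normal_carrierI U_subgroup W_subgroup W_U)

text \<open>Passing from \<open>g\<close> to \<open>g \<otimes> d\<close> uses up one index, since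
  conjugation by \<open>d\<close> only takes \<open>W (Suc n)\<close> into \<open>W n\<close>. The
  induction therefore carries all \<open>n\<close> at once.\<close>

lemma W_trivial: "x = \<one>" if "\<And>n. x \<in> W n"
proof (rule core_free)
  have "x \<in> U" using that[of 0] by simp
  then show x: "x \<in> carrier G" by (rule U_mem)
  fix g assume "g \<in> carrier G"
  then have "\<forall>n. inv g \<otimes> x \<otimes> g \<in> W n"
  proof (rule generated_induct[rotated 2])
    show "\<forall>n. inv \<one> \<otimes> x \<otimes> \<one> \<in> W n" using that x by simp
    fix g d assume g: "g \<in> carrier G" "d \<in> D" "\<forall>n. inv g \<otimes> x \<otimes> g \<in> W n"
    show "\<forall>n. inv (g \<otimes> d) \<otimes> x \<otimes> (g \<otimes> d) \<in> W n"
    proof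
      fix n
      have "inv g \<otimes> x \<otimes> g \<in> W (Suc n)" using g by blast
      then have "inv d \<otimes> (inv g \<otimes> x \<otimes> g) \<otimes> d \<in> W n" using g(2) by simp
      then show "inv (g \<otimes> d) \<otimes> x \<otimes> (g \<otimes> d) \<in> W n"
        using g x D_carrier by (simp add: m_assoc inv_mult_group subset_iff)
    qed
  qed
  then show "inv g \<otimes> x \<otimes> g \<in> U" by (metis W.simps(1))
qed

lemma clopen_separation:
  assumes "x \<in> topspace T" "y \<in> topspace T" "x \<noteq> y"
  shows "\<exists>A. openin T A \<and> closedin T A \<and> x \<in> A \<and> y \<notin> A"
proof -
  have xy: "x \<in> carrier G" "y \<in> carrier G" using assms by auto
  have "y \<otimes> inv x \<noteq> \<one>" using assms(3) xy by (metis inv_equality inv_inv inv_closed)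
  then obtain n where "y \<otimes> inv x \<notin> W n" using W_trivial by blast
  then have "y \<notin> W n #> x" using rcos_eq_preimage[OF W_subgroup xy(1)] by simp
  then show ?thesis
    using open_rcos[OF W_subgroup W_open xy(1)] closed_rcos[OF W_subgroup W_open xy(1)]
      rcos_self[OF xy(1) W_subgroup] by blast
qed

lemma Hausdorff: "Hausdorff_space T" and totally_disconnected: "totally_disconnected_space T"
  using Hausdorff_totally_disconnectedI[of T] clopen_separation by blast+

lemma W_small:
  assumes "openin T A" "\<one> \<in> A"
  obtains n where "W n \<subseteq> A"
proof -
  obtain M where "M \<in> range W" "U \<inter> M \<subseteq> A"
  proof (rule compactin_directed_Inter[OF U_compact, of "range W" A])
    show "closedin T M" if "M \<in> range W" for M
      using that open_subgroup_closed[OF W_subgroup W_open] by blast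
    show "M \<inter> M' \<in> range W" if M: "M \<in> range W" "M' \<in> range W" for M M'
    proof -
      obtain i j where "M = W i" "M' = W j" using M by blast
      then have "M \<inter> M' = W (max i j)"
        using W_antimono[of i j] W_antimono[of j i] by (cases "i \<le> j") (auto simp: max_def)
      then show ?thesis by blast
    qed
    show "U \<inter> \<Inter>(range W) \<subseteq> A" using W_trivial assms(2) by blast
  qed (use assms in auto)
  then show thesis using that W_U by blast
qed

text \<open>\<open>W 1\<close> is the subgroup \<open>L\<close> of the overview: it fixes the base
  point and all its neighbours. The index is finite because \<open>U\<close> is compact and
  \<open>W 1\<close> open.\<close>

definition step_bound :: nat
  where "step_bound = card (cosets G U (W 1))"

text \<open>If \<open>M\<close> lies in the conjugate of \<open>U\<close> by \<open>g\<close>, it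
  normalises the conjugate of \<open>W 1\<close> by \<open>g\<close>. So the intersection
  \<open>N\<close> of the two is normal in \<open>M\<close>, and \<open>M / N\<close> embeds into
  \<open>U / W 1\<close>, whatever \<open>g\<close> is. As \<open>W 1\<close> lies in the conjugate
  of \<open>U\<close> by each \<open>d\<close> in \<open>D\<close>, the group \<open>N\<close> lies
  in the conjugate by \<open>g \<otimes> d\<close>.\<close>

lemma chain_conj:
  assumes "g \<in> carrier G"
  shows "\<exists>M. subnormal_chain G step_bound U M \<and> openin T M \<and> (\<forall>x\<in>M. inv g \<otimes> x \<otimes> g \<in> U)"
  using assms
proof (rule generated_induct[rotated 2])
  show "\<exists>M. subnormal_chain G step_bound U M \<and> openin T M \<and> (\<forall>x\<in>M. inv \<one> \<otimes> x \<otimes> \<one> \<in> U)"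
    using subnormal_chain.refl[OF U_subgroup] U_open U_mem by (intro exI[of _ U]) auto
  fix g d assume g: "g \<in> carrier G" "d \<in> D"
    and "\<exists>M. subnormal_chain G step_bound U M \<and> openin T M \<and> (\<forall>x\<in>M. inv g \<otimes> x \<otimes> g \<in> U)"
  then obtain M where M: "subnormal_chain G step_bound U M" "openin T M" and MU: "\<And>x. x \<in> M \<Longrightarrow> inv g \<otimes> x \<otimes> g \<in> U"
    by blast
  have Ms: "subgroup M G" using chainD[OF M(1)] by simp
  note mem = subgroup.mem_carrier[OF Ms]
  \<comment> \<open>The quantifier over the singleton \<open>{g}\<close> lets
    \<open>subgroup_conj_Inter\<close> and \<open>openin_conj_compact\<close> apply to a single
    conjugate.\<close>
  define N where "N = M \<inter> {x \<in> carrier G. \<forall>c\<in>{g}. inv c \<otimes> x \<otimes> c \<in> W 1}"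
  have memN: "x \<in> N \<longleftrightarrow> x \<in> M \<and> inv g \<otimes> x \<otimes> g \<in> W 1" for x
    using mem by (auto simp: N_def)
  have Ns: "subgroup N G"
    unfolding N_def using g by (intro subgroups_Inter_pair Ms subgroup_conj_Inter W_subgroup) auto
  have "openin T N"
    unfolding N_def using g M(2) by (intro openin_Int openin_conj_compact W_open) auto
  moreover have "N \<lhd> G\<lparr>carrier := M\<rparr>"
  proof (rule normal_carrierI[OF Ms Ns])
    fix a b assume a: "a \<in> M" and b: "b \<in> N"
    then have b': "b \<in> M" "inv g \<otimes> b \<otimes> g \<in> W 1" using memN by auto
    have "(inv g \<otimes> a \<otimes> g) \<otimes> (inv g \<otimes> b \<otimes> g) \<otimes> inv (inv g \<otimes> a \<otimes> g) \<in> W 1"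
      using MU[OF a] b'(2) by (rule W_conj)
    then have "inv g \<otimes> (a \<otimes> b \<otimes> inv a) \<otimes> g \<in> W 1"
      using a b' mem g by (simp add: m_assoc inv_mult_group inv_cancel del: W.simps)
    moreover have "a \<otimes> b \<otimes> inv a \<in> M"
      using a b' subgroup.m_closed[OF Ms] subgroup.m_inv_closed[OF Ms] by blast
    ultimately show "a \<otimes> b \<otimes> inv a \<in> N" using memN by blast
  qed (auto simp: N_def)
  moreover have "finite (cosets G M N)" "card (cosets G M N) \<le> step_bound"
  proof -
    let ?r = "\<lambda>x. W 1 #> (inv g \<otimes> x \<otimes> g)"
    have sub: "?r ` M \<subseteq> cosets G U (W 1)" using MU by (auto simp: cosets_def)
    have finU: "finite (cosets G U (W 1))" using finite_cosets[OF W_subgroup W_open U_compact] .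
    have fin: "finite (?r ` M)" using sub finU by (rule finite_subset)
    have *: "N #> x = N #> y" if xy: "x \<in> M" "y \<in> M" "?r x = ?r y" for x y
    proof -
      have "(inv g \<otimes> x \<otimes> g) \<otimes> inv (inv g \<otimes> y \<otimes> g) \<in> W 1"
        using xy mem g W_subgroup[of 1] by (simp add: rcos_eq_iff del: W.simps)
      then have "inv g \<otimes> (x \<otimes> inv y) \<otimes> g \<in> W 1"
        using xy mem g by (simp add: m_assoc inv_mult_group inv_cancel del: W.simps)
      moreover have "x \<otimes> inv y \<in> M"
        using xy subgroup.m_closed[OF Ms] subgroup.m_inv_closed[OF Ms] by blast
      ultimately show ?thesis using xy mem Ns memN by (simp add: rcos_eq_iff del: W.simps)
    qed
    show "finite (cosets G M N)" unfolding cosets_def using fin * by (rule card_image_factor(1))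
    have "card (cosets G M N) \<le> card (?r ` M)"
      unfolding cosets_def using fin * by (rule card_image_factor(2))
    also have "\<dots> \<le> step_bound" unfolding step_bound_def using finU sub by (rule card_mono)
    finally show "card (cosets G M N) \<le> step_bound" .
  qed
  ultimately have "subnormal_chain G step_bound U N" using subnormal_chain.step[OF M(1)] by blast
  moreover have "inv (g \<otimes> d) \<otimes> x \<otimes> (g \<otimes> d) \<in> U" if "x \<in> N" for x
  proof -
    have x: "x \<in> M" "inv g \<otimes> x \<otimes> g \<in> W 1" using that memN by auto
    then have "inv d \<otimes> (inv g \<otimes> x \<otimes> g) \<otimes> d \<in> U" using g by simp
    then show ?thesis
      using x mem g D_carrier by (simp add: m_assoc inv_mult_group subset_iff del: W.simps)
  qed
  ultimately show "\<exists>M. subnormal_chain G step_bound U M \<and> openin T M \<and> (\<forall>x\<in>M. inv (g \<otimes> d) \<otimes> x \<otimes> (g \<otimes> d) \<in> U)"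
    using \<open>openin T N\<close> by blast
qed

text \<open>By \<open>chain_conj\<close> and \<open>core_free\<close> the open ends of chains
  intersect in the identity only. They are closed sets in the compact \<open>U\<close> and stable
  under intersection, so one of them already lies in \<open>A\<close>.\<close>

lemma chain_small:
  assumes "openin T A" "\<one> \<in> A"
  obtains M where "subnormal_chain G step_bound U M" "openin T M" "M \<subseteq> A"
proof -
  let ?\<M> = "{M. subnormal_chain G step_bound U M \<and> openin T M}"
  obtain M where "M \<in> ?\<M>" "U \<inter> M \<subseteq> A"
  proof (rule compactin_directed_Inter[OF U_compact, of ?\<M> A])
    show "?\<M> \<noteq> {}" using subnormal_chain.refl[OF U_subgroup] U_open by blast
    show "closedin T M" if "M \<in> ?\<M>" for M
      using that open_subgroup_closed[OF chainD(2)] by blast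
    show "M \<inter> M' \<in> ?\<M>" if M: "M \<in> ?\<M>" "M' \<in> ?\<M>" for M M'
      using M chain_Int_chain by blast
    have "x = \<one>" if x: "x \<in> U \<inter> \<Inter>?\<M>" for x
    proof (rule core_free)
      show "x \<in> carrier G" using x U_mem by blast
      fix g assume "g \<in> carrier G"
      then show "inv g \<otimes> x \<otimes> g \<in> U" using chain_conj[of g] x by blast
    qed
    then show "U \<inter> \<Inter>?\<M> \<subseteq> A" using assms(2) by blast
  qed (use assms in auto)
  then show thesis using that chainD(3) by blast
qed

theorem composition_factors_bounded:
  assumes "compact_open_subgroup V G T"
  shows "\<exists>n. \<forall>S\<in>profinite_composition_factors (G\<lparr>carrier := V\<rparr>) (subtopology T V).
    finite (carrier S) \<and> order S \<le> n"
proof -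
  have V: "subgroup V G" "compactin T V" "openin T V"
    using assms by (auto simp: compact_open_subgroup_def)
  obtain A where A: "openin T A" "\<one> \<in> A" "A \<inter> V \<subseteq> U" "A \<inter> V \<lhd> G\<lparr>carrier := V\<rparr>"
    using open_normal_core[OF V(1,2) U_subgroup U_open] .
  define N where "N = A \<inter> V"
  have N: "subgroup N G" "openin T N"
    using A(1,4) V unfolding N_def by (auto simp: normal_carrier_iff)
  \<comment> \<open>The chain from \<open>U\<close> has steps of index at most
    \<open>step_bound\<close>, while the additional first step from \<open>V\<close> to
    \<open>N \<subseteq> U\<close> costs \<open>|V : N|\<close>; hence the bound depends on
    \<open>V\<close>.\<close>
  define n where "n = max step_bound (card (cosets G V N))"
  have VN: "subnormal_chain G n V N"
    using A(4) finite_cosets[OF N V(2)] unfolding N_def[symmetric]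
    by (intro subnormal_chain.step[OF subnormal_chain.refl[OF V(1)]]) (auto simp: n_def)
  have "\<exists>M. subnormal_chain G n V M \<and> M \<subseteq> B" if B: "openin T B" "\<one> \<in> B" for B
  proof -
    obtain M where M: "subnormal_chain G step_bound U M" "M \<subseteq> B" using chain_small[OF B] by blast
    have "subnormal_chain G n N (N \<inter> M)"
      using chain_mono[OF chain_Int[OF M(1) N(1)], of n] A(3) by (simp add: N_def n_def)
    then show ?thesis using chain_trans[OF _ VN] M(2) by blast
  qed
  then show ?thesis using profinite_composition_factor_bound[OF V(1)] by meson
qed

text \<open>For \<open>p\<close> above the bound, an element of \<open>P \<inter> U\<close> has a
  power in \<open>M\<close> with exponent prime to \<open>p\<close>, by the chain, and another whose
  exponent has no prime factor but \<open>p\<close>. So it lies in \<open>M\<close>, and letting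
  \<open>M\<close> shrink it is trivial. Then \<open>P\<close> injects into its finitely many cosets
  modulo \<open>U\<close>.\<close>

theorem local_prime_content_le:
  assumes "p \<in> local_prime_content G T"
  shows "p \<le> step_bound"
proof (rule ccontr)
  assume "\<not> p \<le> step_bound"
  obtain P where p: "prime p" and P: "subgroup P G" "infinite P"
      "pro_group {p} (G\<lparr>carrier := P\<rparr>) (subtopology T P)"
    using assms by (auto simp: local_prime_content_def)
  note mem = subgroup.mem_carrier[OF P(1)]
  have cP: "compactin T P"
    using P(3) subgroup.subset[OF P(1)] by (simp add: pro_group_def profinite_group_def compactin_subspace)
  have triv: "x = \<one>" if x: "x \<in> P" "x \<in> U" for x
  proof (rule W_trivial)
    fix n
    obtain M where M: "subnormal_chain G step_bound U M" "openin T M" "M \<subseteq> W n"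
      using chain_small[OF W_open subgroup.one_closed[OF W_subgroup]] .
    obtain a where a: "\<not> p dvd a" "x [^] a \<in> M"
      using chain_pow[OF M(1) p _ x(2)] \<open>\<not> p \<le> step_bound\<close> by auto
    obtain b :: nat where b: "\<And>q. prime q \<Longrightarrow> q dvd b \<Longrightarrow> q \<in> {p}" "x [^] b \<in> M"
      using pro_group_pow[OF P(3,1) x(1) chainD(2)[OF M(1)] M(2)] by metis
    have "coprime a b"
    proof (rule ccontr)
      assume "\<not> coprime a b"
      then obtain q where "prime q" "q dvd gcd a b"
        using prime_factor_nat[of "gcd a b"] by (auto simp: coprime_iff_gcd_eq_1)
      then show False using a(1) b(1)[of q] by auto
    qed
    then have "x \<in> M" using coprime_pow_mem[OF chainD(2)[OF M(1)] mem[OF x(1)] a(2) b(2)] by simp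
    then show "x \<in> W n" using M(3) by blast
  qed
  have "inj_on (\<lambda>x. U #> x) P"
  proof (rule inj_onI)
    fix x y assume xy: "x \<in> P" "y \<in> P" "U #> x = U #> y"
    then have "x \<otimes> inv y \<in> U" using mem U_subgroup by (simp add: rcos_eq_iff)
    moreover have "x \<otimes> inv y \<in> P"
      using xy subgroup.m_closed[OF P(1)] subgroup.m_inv_closed[OF P(1)] by blast
    ultimately have "x \<otimes> inv y = \<one>" using triv by blast
    then show "x = y" using mem xy by (metis inv_equality inv_inv inv_closed)
  qed
  moreover have "finite ((\<lambda>x. U #> x) ` P)"
    using finite_cosets[OF U_subgroup U_open cP] by (simp add: cosets_def)
  ultimately show False using P(2) finite_imageD by blast
qed

end

section \<open>Sylow subgroups and primes outside the local prime content\<close>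

context core_free_group
begin

text \<open>Each \<open>Y (Suc i)\<close> is chosen inside \<open>Y i\<close> as the preimage of a
  Sylow subgroup of \<open>Y i / W (Suc i)\<close>. Its index in \<open>U\<close> is a product of
  two indices prime to \<open>p\<close>, so the choices are Sylow modulo every \<open>W i\<close>
  and nested as well.\<close>

lemma sylow_sequence:
  assumes "prime p"
  obtains Y where "\<And>i. subgroup (Y i) G" "\<And>i. W i \<subseteq> Y i" "\<And>i. Y i \<subseteq> U"
    "\<And>i. \<exists>k. card (cosets G (Y i) (W i)) = p ^ k" "\<And>i. \<not> p dvd card (cosets G U (Y i))"
    "\<And>i j. i \<le> j \<Longrightarrow> Y j \<subseteq> Y i"
proof -
  define P where "P i Z \<longleftrightarrow> subgroup Z G \<and> W i \<subseteq> Z \<and> Z \<subseteq> U \<and>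
    (\<exists>k. card (cosets G Z (W i)) = p ^ k) \<and> \<not> p dvd card (cosets G U Z)" for i Z
  have finU: "finite (cosets G U (W i))" for i
    using finite_cosets[OF W_subgroup W_open U_compact] .
  have "\<exists>Y. \<forall>n. P n (Y n) \<and> Y (Suc n) \<subseteq> Y n"
  proof (rule dependent_nat_choice)
    obtain S k where "subgroup S G" "W 0 \<subseteq> S" "S \<subseteq> U" "card (cosets G S (W 0)) = p ^ k"
        "\<not> p dvd card (cosets G U S)"
      using sylow_between[OF U_subgroup W_normal finU assms] .
    then show "\<exists>Z. P 0 Z" unfolding P_def by blast
  next
    fix Z i assume "P i Z"
    then have Z: "subgroup Z G" "W i \<subseteq> Z" "Z \<subseteq> U" "\<not> p dvd card (cosets G U Z)"
      by (auto simp: P_def)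
    have WZ: "W (Suc i) \<subseteq> Z" using Z(2) W_antimono[of i "Suc i"] by auto
    have nor: "W (Suc i) \<lhd> G\<lparr>carrier := Z\<rparr>"
      using Z(3) W_conj by (intro normal_carrierI Z(1) W_subgroup WZ) blast
    have "finite (cosets G Z (W (Suc i)))"
      using finU[of "Suc i"] Z(3) by (rule_tac finite_subset[rotated]) (auto simp: cosets_def)
    then obtain S k where S: "subgroup S G" "W (Suc i) \<subseteq> S" "S \<subseteq> Z"
        "card (cosets G S (W (Suc i))) = p ^ k" "\<not> p dvd card (cosets G Z S)"
      using sylow_between[OF Z(1) nor _ assms] by metis
    have "openin T S"
      using open_subgroupI[OF S(1) W_open _ S(2)] subgroup.one_closed[OF W_subgroup] by blast
    then have "card (cosets G U S) = card (cosets G U Z) * card (cosets G Z S)"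
      using finite_cosets[OF S(1) _ U_compact] by (intro cosets_tower U_subgroup Z S)
    then have "\<not> p dvd card (cosets G U S)"
      using Z(4) S(5) assms by (simp add: prime_dvd_mult_iff)
    then show "\<exists>Y. P (Suc i) Y \<and> Y \<subseteq> Z"
      using S Z(3) unfolding P_def by blast
  qed
  then obtain Y where Y: "\<And>n. P n (Y n)" "\<And>n. Y (Suc n) \<subseteq> Y n" by blast
  have "Y j \<subseteq> Y i" if "i \<le> j" for i j
    using Y(2) that by (rule lift_Suc_antimono_le)
  with Y(1) show thesis using that[of Y] unfolding P_def by blast
qed

text \<open>The intersection of such a sequence is a \<open>p\<close>-Sylow subgroup of \<open>U\<close>. For \<open>p\<close> outside the local
  prime content it is finite, so it meets some \<open>W i\<close> trivially, and then \<open>p\<close> does not divide the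
  indices below \<open>W i\<close>.\<close>

lemma eventually_prime_free:
  assumes "prime p" "p \<notin> local_prime_content G T"
  obtains i where "\<And>k. i \<le> k \<Longrightarrow> \<not> p dvd card (cosets G (W i) (W k))"
proof -
  obtain Y where Y: "\<And>i. subgroup (Y i) G" "\<And>i. W i \<subseteq> Y i" "\<And>i. Y i \<subseteq> U"
    "\<And>i. \<exists>k. card (cosets G (Y i) (W i)) = p ^ k" "\<And>i. \<not> p dvd card (cosets G U (Y i))"
    "\<And>i j. i \<le> j \<Longrightarrow> Y j \<subseteq> Y i"
    using sylow_sequence[OF assms(1)] by metis
  have Yo: "openin T (Y i)" for i
    using open_subgroupI[OF Y(1) W_open _ Y(2)] subgroup.one_closed[OF W_subgroup] by blast
  have Yc: "closedin T (Y i)" for i using open_subgroup_closed[OF Y(1) Yo] .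
  define X where "X = (\<Inter>i. Y i)"
  have Xs: "subgroup X G" unfolding X_def using Y(1) by (intro subgroups_Inter) auto
  have XU: "X \<subseteq> U" using Y(3) by (auto simp: X_def)
  have "closedin T X" unfolding X_def using Yc by (intro closedin_Inter) auto
  then have cX: "compactin T X" using closed_compactin[OF U_compact XU] by blast
  have "finite X"
  proof (rule ccontr)
    assume "infinite X"
    moreover have "pro_group {p} (G\<lparr>carrier := X\<rparr>) (subtopology T X)"
    proof (rule pro_groupI)
      show "profinite_group (G\<lparr>carrier := X\<rparr>) (subtopology T X)"
        using profinite_subgroup[OF Xs cX Hausdorff totally_disconnected] .
      fix q x A assume q: "prime q" "q \<notin> {p}" and x: "x \<in> X" and A: "openin T A" "\<one> \<in> A"
      obtain i where i: "W i \<subseteq> A" using W_small[OF A] .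
      \<comment> \<open>The element \<open>x\<close> lies in every \<open>Y i\<close>, whose index
        over \<open>W i\<close> is a power of \<open>p\<close>; this exponent is prime to every
        prime other than \<open>p\<close>.\<close>
      obtain k where k: "card (cosets G (Y i) (W i)) = p ^ k" using Y(4) by blast
      have "W i \<lhd> G\<lparr>carrier := Y i\<rparr>"
        using Y(3) W_conj by (intro normal_carrierI Y(1,2) W_subgroup) blast
      then have "x [^] (p ^ k) \<in> W i"
        using pow_index_mem[OF Y(1)[of i], of "W i" x] x k by (auto simp: X_def)
      moreover have "\<not> q dvd p ^ k"
        using q assms(1) by (metis prime_dvd_power primes_dvd_imp_eq singletonI)
      ultimately show "\<exists>a. \<not> q dvd a \<and> x [^] (a::nat) \<in> A" using i by blast
    qed (rule Xs)
    ultimately show False using assms Xs by (auto simp: local_prime_content_def)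
  qed
  then have "\<forall>\<^sub>F i in sequentially. \<forall>x\<in>X - {\<one>}. x \<notin> W i"
  proof (intro eventually_ball_finite ballI)
    fix x assume "x \<in> X - {\<one>}"
    then obtain n where "x \<notin> W n" using W_trivial by blast
    then show "\<forall>\<^sub>F i in sequentially. x \<notin> W i"
      using W_antimono[of n] by (intro eventually_sequentiallyI[of n]) blast
  qed simp
  then obtain i where i: "\<And>x. x \<in> X \<Longrightarrow> x \<in> W i \<Longrightarrow> x = \<one>"
    by (auto simp: eventually_sequentially)
  have "\<not> p dvd card (cosets G (W i) (W k))" if ik: "i \<le> k" for k
  proof -
    have cW: "compactin T (W i)"
      using closed_compactin[OF U_compact W_U open_subgroup_closed[OF W_subgroup W_open]] .
    \<comment> \<open>By compactness the trivial intersection of \<open>W i\<close> with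
      \<open>X\<close> is felt at a finite stage \<open>Y j\<close>. Then \<open>|W i : W k|\<close>
      divides \<open>|W i : W i \<inter> Y j|\<close>, which divides \<open>|U : Y j|\<close>, a
      number prime to \<open>p\<close>.\<close>
    obtain M where M: "M \<in> range Y" "W i \<inter> M \<subseteq> W k"
    proof (rule compactin_directed_Inter[OF cW, of "range Y" "W k"])
      show "M \<inter> M' \<in> range Y" if M: "M \<in> range Y" "M' \<in> range Y" for M M'
      proof -
        obtain i j where "M = Y i" "M' = Y j" using M by blast
        then have "M \<inter> M' = Y (max i j)"
          using Y(6)[of i j] Y(6)[of j i] by (cases "i \<le> j") (auto simp: max_def)
        then show ?thesis by blast
      qed
      have "W i \<inter> \<Inter> (range Y) \<subseteq> {\<one>}" using i by (auto simp: X_def)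
      then show "W i \<inter> \<Inter> (range Y) \<subseteq> W k" using subgroup.one_closed[OF W_subgroup] by blast
    qed (use Yc W_open in auto)
    then obtain j where j: "W i \<inter> Y j \<subseteq> W k" by blast
    have sub: "subgroup (W i \<inter> Y j) G" using subgroups_Inter_pair[OF W_subgroup Y(1)] .
    have "openin T (W i \<inter> Y j)" using W_open Yo by blast
    then have fin: "finite (cosets G (W i) (W i \<inter> Y j))" using finite_cosets[OF sub _ cW] by blast
    have "card (cosets G (W i) (W i \<inter> Y j)) dvd card (cosets G U (Y j))"
      using cosets_normal_dvd[OF U_subgroup W_normal Y(1,3) finite_cosets[OF Y(1) Yo U_compact]] .
    then have "\<not> p dvd card (cosets G (W i) (W i \<inter> Y j))" using Y(5) dvd_trans by blast
    moreover have "card (cosets G (W i) (W i \<inter> Y j)) =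
        card (cosets G (W i) (W k)) * card (cosets G (W k) (W i \<inter> Y j))"
      using cosets_tower[OF W_subgroup W_subgroup sub j W_antimono[OF ik] fin] .
    ultimately show ?thesis by auto
  qed
  then show thesis using that by blast
qed

text \<open>The exponent is \<open>|W i : W k|\<close> for some \<open>W k\<close> inside the given
  neighbourhood. As \<open>i\<close> depends on neither \<open>x\<close> nor \<open>A\<close>,
  finitely many primes can share one \<open>i\<close>.\<close>

lemma prime_free_pow:
  assumes "prime p" "p \<notin> local_prime_content G T"
  shows "\<exists>i. \<forall>x\<in>W i. \<forall>A. openin T A \<longrightarrow> \<one> \<in> A \<longrightarrow> (\<exists>a. \<not> p dvd a \<and> x [^] (a::nat) \<in> A)"
proof -
  obtain i where i: "\<And>k. i \<le> k \<Longrightarrow> \<not> p dvd card (cosets G (W i) (W k))"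
    using eventually_prime_free[OF assms] by metis
  have "\<exists>a. \<not> p dvd a \<and> x [^] (a::nat) \<in> A" if x: "x \<in> W i" and A: "openin T A" "\<one> \<in> A" for x A
  proof -
    obtain n where n: "W n \<subseteq> A" using W_small[OF A] .
    define k where "k = max i n"
    have "W k \<lhd> G\<lparr>carrier := W i\<rparr>"
      using W_conj W_U[of i] W_antimono[of i k]
      by (intro normal_carrierI W_subgroup) (auto simp: k_def)
    then have "x [^] card (cosets G (W i) (W k)) \<in> W k"
      using pow_index_mem[OF W_subgroup _ x] by blast
    moreover have "W k \<subseteq> A" using n W_antimono[of n k] by (auto simp: k_def)
    ultimately show ?thesis using i[of k] by (auto simp: k_def)
  qed
  then show ?thesis by blast
qed

theorem virtually_pro_local_prime_content:
  assumes "compact_open_subgroup V G T"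
  shows "virtually_pro_group (local_prime_content G T) (G\<lparr>carrier := V\<rparr>) (subtopology T V)"
proof -
  have V: "subgroup V G" "compactin T V" "openin T V"
    using assms by (auto simp: compact_open_subgroup_def)
  let ?\<eta> = "local_prime_content G T"
  define free where "free p i \<longleftrightarrow> (\<forall>x\<in>W i. \<forall>A. openin T A \<longrightarrow> \<one> \<in> A \<longrightarrow>
    (\<exists>a. \<not> p dvd a \<and> x [^] (a::nat) \<in> A))" for p i
  have "\<forall>\<^sub>F i in sequentially. \<forall>p\<in>{p. prime p \<and> p \<notin> ?\<eta>} \<inter> {..step_bound}. free p i"
  proof (intro eventually_ball_finite ballI)
    fix p assume "p \<in> {p. prime p \<and> p \<notin> ?\<eta>} \<inter> {..step_bound}"
    then obtain i where "free p i" unfolding free_def using prime_free_pow[of p] by auto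
    then show "\<forall>\<^sub>F i in sequentially. free p i"
      unfolding free_def by (intro eventually_sequentiallyI[of i]) (meson W_antimono subsetD)
  qed simp
  then obtain i where i: "\<And>p. prime p \<Longrightarrow> p \<notin> ?\<eta> \<Longrightarrow> p \<le> step_bound \<Longrightarrow> free p i"
    by (auto simp: eventually_sequentially)
  define Z where "Z = W i \<inter> V"
  have Z: "subgroup Z G" "openin T Z" "Z \<subseteq> V"
    unfolding Z_def using subgroups_Inter_pair[OF W_subgroup V(1)] W_open V(3) by auto
  have cZ: "compactin T Z" using closed_compactin[OF V(2) Z(3) open_subgroup_closed[OF Z(1,2)]] .
  have "pro_group ?\<eta> (G\<lparr>carrier := Z\<rparr>) (subtopology T Z)"
  proof (rule pro_groupI)
    show "profinite_group (G\<lparr>carrier := Z\<rparr>) (subtopology T Z)"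
      using profinite_subgroup[OF Z(1) cZ Hausdorff totally_disconnected] .
    fix q x A assume q: "prime q" "q \<notin> ?\<eta>" and x: "x \<in> Z" and A: "openin T A" "\<one> \<in> A"
    show "\<exists>a. \<not> q dvd a \<and> x [^] (a::nat) \<in> A"
    \<comment> \<open>The index \<open>i\<close> serves the finitely many primes up to
      \<open>step_bound\<close>. Above it, a chain from \<open>U\<close> into \<open>A\<close>
      yields an exponent prime to \<open>q\<close> for every element of \<open>U\<close>.\<close>
    proof (cases "q \<le> step_bound")
      case True
      then show ?thesis using i[OF q] x A by (auto simp: free_def Z_def)
    next
      case False
      obtain M where M: "subnormal_chain G step_bound U M" "M \<subseteq> A" using chain_small[OF A] by metis
      have "x \<in> U" using x W_U[of i] by (auto simp: Z_def)
      then show ?thesis using chain_pow[OF M(1) q(1)] False M(2) by (meson not_le subsetD)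
    qed
  qed (rule Z)
  moreover have "subgroup Z (G\<lparr>carrier := V\<rparr>)" using Z V by (intro subgroup_incl)
  moreover have "openin (subtopology T V) Z"
    using Z by (auto simp: openin_subtopology)
  moreover have "subtopology (subtopology T V) Z = subtopology T Z"
    using Z(3) by (simp add: subtopology_subtopology Int_absorb1)
  ultimately show ?thesis
    using profinite_subgroup[OF V(1,2) Hausdorff totally_disconnected]
    unfolding virtually_pro_group_def by (intro conjI exI[of _ Z]) simp_all
qed

end

section \<open>The quotient by the core\<close>

text \<open>A product of quotient maps need not be a quotient map, but a product of open maps is
  open; this is what lets multiplication on \<open>G Mod K\<close> inherit continuity.\<close>

lemma open_map_prod:
  assumes "open_map X X' f" "open_map Y Y' g"
  shows "open_map (prod_topology X Y) (prod_topology X' Y') (\<lambda>(x, y). (f x, g y))"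
  unfolding open_map_def
proof (intro allI impI)
  fix S assume S: "openin (prod_topology X Y) S"
  show "openin (prod_topology X' Y') ((\<lambda>(x, y). (f x, g y)) ` S)"
    unfolding openin_prod_topology_alt
  proof (intro allI impI)
    fix a b assume "(a, b) \<in> (\<lambda>(x, y). (f x, g y)) ` S"
    then obtain x y where xy: "(x, y) \<in> S" "a = f x" "b = g y" by auto
    then obtain A B where AB: "openin X A" "openin Y B" "x \<in> A" "y \<in> B" "A \<times> B \<subseteq> S"
      using S unfolding openin_prod_topology_alt by meson
    have "f ` A \<times> g ` B \<subseteq> (\<lambda>(x, y). (f x, g y)) ` S" using AB(5) by force
    moreover have "openin X' (f ` A)" "openin Y' (g ` B)"
      using AB assms by (auto simp: open_map_def)
    ultimately show "\<exists>U V. openin X' U \<and> openin Y' V \<and> a \<in> U \<and> b \<in> V \<and>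
        U \<times> V \<subseteq> (\<lambda>(x, y). (f x, g y)) ` S"
      using AB(3,4) xy(2,3) by (intro exI[of _ "f ` A"] exI[of _ "g ` B"]) simp
  qed
qed

context topological_group
begin

text \<open>The saturation of an open set is a union of its translates by elements of
  \<open>K\<close>, so the projection is open. Hence its square is a quotient map too, and
  continuity of both operations descends from \<open>G\<close>.\<close>

lemma topological_group_quotient:
  assumes "K \<lhd> G"
  shows "topological_group (G Mod K) (quotient_group_topology G T K)"
    "continuous_map T (quotient_group_topology G T K) (\<lambda>x. K #> x)"
    "open_map T (quotient_group_topology G T K) (\<lambda>x. K #> x)"
proof -
  let ?TQ = "quotient_group_topology G T K" and ?q = "\<lambda>x. K #> x"
  interpret Q: group "G Mod K" using assms by (rule normal.factorgroup_is_group)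
  have K: "subgroup K G" using assms by (rule normal_imp_subgroup)
  have quo: "quotient_map T ?TQ ?q"
    using quotient_map_quotient_group_topology[OF topspace_eq_carrier] .
  then show cont: "continuous_map T ?TQ ?q" by (rule quotient_imp_continuous_map)
  have cQ: "carrier (G Mod K) = ?q ` carrier G" by (rule carrier_FactGroup)
  have tQ: "topspace ?TQ = carrier (G Mod K)"
    using quotient_imp_surjective_map[OF quo] cQ by simp
  show "open_map T ?TQ ?q"
    unfolding open_map_def
  proof (intro allI impI)
    fix A assume A: "openin T A"
    then have Ac: "A \<subseteq> carrier G" using openin_subset by fastforce
    have "{x \<in> carrier G. ?q x \<in> ?q ` A} = (\<Union>k\<in>K. {x \<in> carrier G. k \<otimes> x \<in> A})"
    proof (intro equalityI subsetI)
      fix x assume "x \<in> {x \<in> carrier G. ?q x \<in> ?q ` A}"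
      then obtain a where a: "x \<in> carrier G" "a \<in> A" "?q x = ?q a" by blast
      then have "a \<otimes> inv x \<in> K" using rcos_eq_iff[OF K, of a x] Ac by auto
      moreover have "(a \<otimes> inv x) \<otimes> x \<in> A" using a Ac by (simp add: m_assoc subset_iff)
      ultimately show "x \<in> (\<Union>k\<in>K. {x \<in> carrier G. k \<otimes> x \<in> A})" using a by blast
    next
      fix x assume "x \<in> (\<Union>k\<in>K. {x \<in> carrier G. k \<otimes> x \<in> A})"
      then obtain k where k: "k \<in> K" "x \<in> carrier G" "k \<otimes> x \<in> A" by blast
      have "?q (k \<otimes> x) = ?q x"
        using k subgroup.mem_carrier[OF K] by (simp add: rcos_eq_iff[OF K] m_assoc)
      then show "x \<in> {x \<in> carrier G. ?q x \<in> ?q ` A}" using k by (metis (mono_tags) imageI mem_Collect_eq)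
    qed
    moreover have "openin T (\<Union>k\<in>K. {x \<in> carrier G. k \<otimes> x \<in> A})"
      using openin_lmult[OF A] subgroup.mem_carrier[OF K] by (intro openin_clauses(3)) auto
    ultimately show "openin ?TQ (?q ` A)"
      using Ac cQ by (auto simp: openin_quotient_group_topology)
  qed
  then have open_prod: "open_map (prod_topology T T) (prod_topology ?TQ ?TQ) (\<lambda>(x, y). (?q x, ?q y))"
    using \<open>open_map T ?TQ ?q\<close> by (intro open_map_prod)
  have "quotient_map (prod_topology T T) (prod_topology ?TQ ?TQ) (\<lambda>(x, y). (?q x, ?q y))"
    using cont open_prod cQ tQ by (intro continuous_open_imp_quotient_map)
      (auto simp: continuous_map_prod_top image_def)
  moreover have "continuous_map (prod_topology T T) ?TQ
      ((\<lambda>(X, Y). X <#> Y) \<circ> (\<lambda>(x, y). (?q x, ?q y)))"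
  proof (rule continuous_map_eq)
    show "continuous_map (prod_topology T T) ?TQ (\<lambda>z. ?q (fst z \<otimes> snd z))"
      using continuous_map_compose[OF continuous_mult cont] by (simp add: o_def case_prod_unfold)
  qed (auto simp: normal.rcos_sum[OF assms])
  ultimately have "continuous_map (prod_topology ?TQ ?TQ) ?TQ (\<lambda>(X, Y). X <#> Y)"
    by (rule continuous_compose_quotient_map)
  moreover have "continuous_map T ?TQ ((\<lambda>X. inv\<^bsub>G Mod K\<^esub> X) \<circ> ?q)"
  proof (rule continuous_map_eq)
    show "continuous_map T ?TQ (\<lambda>x. ?q (inv x))"
      using continuous_map_compose[OF continuous_inv cont] by (simp add: o_def)
    fix x assume x: "x \<in> topspace T"
    then have "?q x \<in> carrier (G Mod K)" using cQ by simp
    then show "?q (inv x) = ((\<lambda>X. inv\<^bsub>G Mod K\<^esub> X) \<circ> ?q) x"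
      using x by (simp add: normal.inv_FactGroup[OF assms] normal.rcos_inv[OF assms])
  qed
  with quo have "continuous_map ?TQ ?TQ (\<lambda>X. inv\<^bsub>G Mod K\<^esub> X)"
    by (rule continuous_compose_quotient_map)
  ultimately show "topological_group (G Mod K) ?TQ"
    using tQ by unfold_locales simp_all
qed

end

theorem proposition4p6:
  fixes G :: "('a, 'b) monoid_scheme" and T :: "'a topology" and W :: "'a set"
  assumes "tdlc_group G T"
    and "compactly_generated_group G T"
    and "T \<noteq> discrete_topology (carrier G)"
    and "openin T W" and "\<one>\<^bsub>G\<^esub> \<in> W"
  shows "\<exists>K. K \<lhd> G \<and> compactin T K \<and> K \<subseteq> W \<and>
    (let Q = G Mod K;
         TQ = quotient_group_topology G T K;
         \<eta> = local_prime_content Q TQ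
     in (\<forall>U. compact_open_subgroup U G T \<longrightarrow>
           (\<exists>n. \<forall>S \<in> profinite_composition_factors
                    (Q\<lparr>carrier := image_in_quotient G U K\<rparr>)
                    (subtopology TQ (image_in_quotient G U K)).
              finite (carrier S) \<and> order S \<le> n)) \<and>
        finite \<eta> \<and>
        (\<forall>U. compact_open_subgroup U G T \<longrightarrow>
           virtually_pro_group \<eta> (Q\<lparr>carrier := image_in_quotient G U K\<rparr>)
             (subtopology TQ (image_in_quotient G U K))))"
proof -
  interpret topological_group G T using assms(1) by (simp add: tdlc_group_def)
  obtain U where U: "compact_open_subgroup U G T" "U \<subseteq> W" using van_dantzig[OF assms(1,4,5)] .
  have Us: "subgroup U G" and Uc: "compactin T U" and Uo: "openin T U"
    using U(1) by (auto simp: compact_open_subgroup_def)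
  obtain C where C: "compactin T C" "generate G C = carrier G"
    using assms(2) by (auto simp: compactly_generated_group_def)
  define K where "K = {x \<in> carrier G. \<forall>g\<in>carrier G. inv\<^bsub>G\<^esub> g \<otimes>\<^bsub>G\<^esub> x \<otimes>\<^bsub>G\<^esub> g \<in> U}"
  have Ks: "subgroup K G" unfolding K_def using Us by (rule subgroup_conj_Inter) simp
  note Kmem = subgroup.mem_carrier[OF Ks]
  have KU: "K \<subseteq> U"
  proof
    fix x assume "x \<in> K"
    then have "inv\<^bsub>G\<^esub> \<one>\<^bsub>G\<^esub> \<otimes>\<^bsub>G\<^esub> x \<otimes>\<^bsub>G\<^esub> \<one>\<^bsub>G\<^esub> \<in> U" "x \<in> carrier G" unfolding K_def by blast+
    then show "x \<in> U" by simp
  qed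
  have conjK: "a \<otimes>\<^bsub>G\<^esub> x \<otimes>\<^bsub>G\<^esub> inv\<^bsub>G\<^esub> a \<in> K" if a: "a \<in> carrier G" "x \<in> K" for a x
  proof -
    have x: "x \<in> carrier G" using Kmem a by blast
    have "inv\<^bsub>G\<^esub> g \<otimes>\<^bsub>G\<^esub> (a \<otimes>\<^bsub>G\<^esub> x \<otimes>\<^bsub>G\<^esub> inv\<^bsub>G\<^esub> a) \<otimes>\<^bsub>G\<^esub> g \<in> U" if g: "g \<in> carrier G" for g
    proof -
      have "inv\<^bsub>G\<^esub> (inv\<^bsub>G\<^esub> a \<otimes>\<^bsub>G\<^esub> g) \<otimes>\<^bsub>G\<^esub> x \<otimes>\<^bsub>G\<^esub> (inv\<^bsub>G\<^esub> a \<otimes>\<^bsub>G\<^esub> g) \<in> U"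
        using a g unfolding K_def by blast
      then show ?thesis using a(1) x g by (simp add: m_assoc inv_mult_group)
    qed
    then show ?thesis using a x unfolding K_def by simp
  qed
  have nK: "K \<lhd> G" using normal_invI[OF Ks] conjK by blast
  have cK: "compactin T K"
  proof -
    \<comment> \<open>The conjugating elements range over all of \<open>G\<close>, which may fail to
      be compact, so only closedness of \<open>K\<close> is obtained: each single conjugate is an
      open subgroup, hence closed.\<close>
    have "closedin T {x \<in> carrier G. \<forall>c\<in>{g}. inv\<^bsub>G\<^esub> c \<otimes>\<^bsub>G\<^esub> x \<otimes>\<^bsub>G\<^esub> c \<in> U}" if "g \<in> carrier G" for g
      using that by (intro open_subgroup_closed subgroup_conj_Inter openin_conj_compact Us Uo) auto
    then have "closedin T (\<Inter>g\<in>carrier G. {x \<in> carrier G. \<forall>c\<in>{g}. inv\<^bsub>G\<^esub> c \<otimes>\<^bsub>G\<^esub> x \<otimes>\<^bsub>G\<^esub> c \<in> U})"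
      by (intro closedin_Inter) auto
    moreover have "(\<Inter>g\<in>carrier G. {x \<in> carrier G. \<forall>c\<in>{g}. inv\<^bsub>G\<^esub> c \<otimes>\<^bsub>G\<^esub> x \<otimes>\<^bsub>G\<^esub> c \<in> U}) = K"
      unfolding K_def by auto
    ultimately show ?thesis using closed_compactin[OF Uc KU] by simp
  qed
  let ?Q = "G Mod K" and ?TQ = "quotient_group_topology G T K" and ?q = "\<lambda>x. K #>\<^bsub>G\<^esub> x"
  interpret Q: topological_group ?Q ?TQ using topological_group_quotient(1)[OF nK] .
  interpret q: group_hom G ?Q ?q
    using normal.r_coset_hom_Mod[OF nK] by unfold_locales
  note cont = topological_group_quotient(2)[OF nK] and opn = topological_group_quotient(3)[OF nK]
  have img: "compact_open_subgroup (?q ` V) ?Q ?TQ" if "compact_open_subgroup V G T" for V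
    using that cont opn q.subgroup_img_is_subgroup[of V]
    by (auto simp: compact_open_subgroup_def open_map_def image_compactin)
  have iq: "image_in_quotient G V K = ?q ` V" if "compact_open_subgroup V G T" for V
  proof -
    have V: "V \<subseteq> carrier G" using that by (auto simp: compact_open_subgroup_def subgroup.subset)
    \<comment> \<open>By normality \<open>v \<otimes> k\<close> lies in the coset
      \<open>K #> v\<close>, so the factor \<open>K\<close> in \<open>U K / K\<close> does not
      change the image.\<close>
    have eq: "?q (v \<otimes>\<^bsub>G\<^esub> k) = ?q v" if "v \<in> V" "k \<in> K" for v k
      using that V Kmem conjK[of v k] by (simp add: rcos_eq_iff[OF Ks] subset_iff del: q.hom_mult)
    have "image_in_quotient G V K = (\<Union>v\<in>V. \<Union>k\<in>K. {?q (v \<otimes>\<^bsub>G\<^esub> k)})"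
      by (auto simp: image_in_quotient_def set_mult_def)
    also have "\<dots> = (\<Union>v\<in>V. \<Union>k\<in>K. {?q v})" using eq by simp
    also have "\<dots> = ?q ` V" using subgroup.one_closed[OF Ks] by auto
    finally show ?thesis .
  qed
  interpret Q: core_free_group ?Q ?TQ "?q ` U" "?q ` C"
  proof
    show "compact_open_subgroup (?q ` U) ?Q ?TQ" using img U(1) .
    show "compactin ?TQ (?q ` C)" using image_compactin[OF C(1) cont] .
    show "generate ?Q (?q ` C) = carrier ?Q"
      using q.generate_img[of C] compactin_subset_topspace[OF C(1)] C(2) carrier_FactGroup[of G K]
      by simp
    fix X assume X: "X \<in> carrier ?Q"
      and conj: "\<And>g. g \<in> carrier ?Q \<Longrightarrow> inv\<^bsub>?Q\<^esub> g \<otimes>\<^bsub>?Q\<^esub> X \<otimes>\<^bsub>?Q\<^esub> g \<in> ?q ` U"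
    obtain x where x: "x \<in> carrier G" "X = ?q x" using X by (auto simp: carrier_FactGroup)
    have "inv\<^bsub>G\<^esub> g \<otimes>\<^bsub>G\<^esub> x \<otimes>\<^bsub>G\<^esub> g \<in> U" if g: "g \<in> carrier G" for g
    proof -
      have "inv\<^bsub>?Q\<^esub> (?q g) \<otimes>\<^bsub>?Q\<^esub> X \<otimes>\<^bsub>?Q\<^esub> ?q g = ?q (inv\<^bsub>G\<^esub> g \<otimes>\<^bsub>G\<^esub> x \<otimes>\<^bsub>G\<^esub> g)"
        using g x by (simp del: mult_FactGroup)
      then obtain u where u: "u \<in> U" "?q (inv\<^bsub>G\<^esub> g \<otimes>\<^bsub>G\<^esub> x \<otimes>\<^bsub>G\<^esub> g) = ?q u"
        using conj[of "?q g"] q.hom_closed[OF g] by auto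
      let ?y = "inv\<^bsub>G\<^esub> g \<otimes>\<^bsub>G\<^esub> x \<otimes>\<^bsub>G\<^esub> g"
      have c: "?y \<in> carrier G" "u \<in> carrier G" using g x u subgroup.mem_carrier[OF Us] by auto
      \<comment> \<open>Because \<open>K \<subseteq> U\<close>, a coset of \<open>K\<close> in the
        image of \<open>U\<close> consists of elements of \<open>U\<close>. The condition on
        conjugates therefore lifts to \<open>G\<close> and puts \<open>x\<close> into
        \<open>K\<close>.\<close>
      have "?y \<otimes>\<^bsub>G\<^esub> inv\<^bsub>G\<^esub> u \<in> U" using u c KU by (auto simp: rcos_eq_iff[OF Ks])
      then have "?y \<otimes>\<^bsub>G\<^esub> inv\<^bsub>G\<^esub> u \<otimes>\<^bsub>G\<^esub> u \<in> U" using u(1) subgroup.m_closed[OF Us] by blast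
      moreover have "z \<otimes>\<^bsub>G\<^esub> inv\<^bsub>G\<^esub> u \<otimes>\<^bsub>G\<^esub> u = z" if "z \<in> carrier G" for z
        using that c(2) by (simp add: m_assoc)
      ultimately show ?thesis using c(1) by metis
    qed
    then have "x \<in> K" using x by (simp add: K_def)
    then show "X = \<one>\<^bsub>?Q\<^esub>" using x coset_join2[OF x(1) Ks] by simp
  qed
  have "\<exists>n. \<forall>S\<in>profinite_composition_factors (?Q\<lparr>carrier := image_in_quotient G V K\<rparr>)
        (subtopology ?TQ (image_in_quotient G V K)). finite (carrier S) \<and> order S \<le> n"
    if "compact_open_subgroup V G T" for V
    using Q.composition_factors_bounded[OF img[OF that]] iq[OF that] by simp
  moreover have "finite (local_prime_content ?Q ?TQ)"
  proof (rule finite_subset)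
    show "local_prime_content ?Q ?TQ \<subseteq> {..Q.step_bound}"
      by (rule subsetI) (simp only: atMost_iff Q.local_prime_content_le)
  qed simp
  moreover have "virtually_pro_group (local_prime_content ?Q ?TQ)
      (?Q\<lparr>carrier := image_in_quotient G V K\<rparr>) (subtopology ?TQ (image_in_quotient G V K))"
    if "compact_open_subgroup V G T" for V
    using Q.virtually_pro_local_prime_content[OF img[OF that]] iq[OF that] by simp
  ultimately show ?thesis
    unfolding Let_def using nK cK KU U(2) by (intro exI[of _ K]) blast
qed

end
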